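(* Let $\mathcal{C}$ be a TS-covering of $\mathbb{S}^2$ by finitely many congruent spherical caps of angular radius $\rho$, where $0<\rho<\frac{\pi}{2}$. Then $$\Delta(\rho):=\frac{\pi(1-\cos\rho)}{4\arctan\left(\frac{1}{\cos\rho}\right)-\pi}\le\delta(\mathcal{C}).$$
   Context: $\mathbb{S}^2$ is the unit sphere centered at the origin in Euclidean $3$-space. A great circle is the intersection of $\mathbb{S}^2$ with a plane through the origin. The (closed) spherical cap of center $\mathbf{x}\in\mathbb{S}^2$ and angular radius $r\in(0,\frac{\pi}{2}]$ is $\{\mathbf{y}\in\mathbb{S}^2:\langle\mathbf{y},\mathbf{x}\rangle\ge\cos r\}$. Finitely many great circles generate a tiling of $\mathbb{S}^2$ whose $2$-dimensional cells are the closures of the connected components of the complement of their union. A covering $\mathcal{C}$ of $\mathbb{S}^2$ by (congruent) spherical caps is a totally separable covering (TS-covering) if there exists a tiling $\mathcal{T}$ generated by finitely many great circles of $\mathbb{S}^2$ such that the $2$-dimensional cells of $\mathcal{T}$ are covered by pairwise distinct spherical caps of $\mathcal{C}$ (each cell is contained in one cap of $\mathcal{C}$, with distinct cells assigned distinct caps). If $\mathcal{C}$ consists of the $m$ caps $C_1,\ldots,C_m$ of angular radius $\rho$, its density is $\delta(\mathcal{C})=\frac{\sum_{i=1}^m\mathrm{Sarea}(C_i)}{\mathrm{Sarea}(\mathbb{S}^2)}=\frac{1-\cos\rho}{2}\,m$, where $\mathrm{Sarea}$ is spherical area. *)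

theory Defs
  imports "HOL-Analysis.Analysis"
begin

abbreviation S2 :: "(real^3) set" where
  "S2 \<equiv> sphere 0 1"

definition great_circle :: "(real^3) set \<Rightarrow> bool" where
  "great_circle G \<longleftrightarrow> (\<exists>P. subspace P \<and> dim P = 2 \<and> G = S2 \<inter> P)"

definition spherical_cap :: "real^3 \<Rightarrow> real \<Rightarrow> (real^3) set" where
  "spherical_cap x r = {y \<in> S2. y \<bullet> x \<ge> cos r}"

text \<open>The closure is taken in the ambient space; as \<open>S2\<close> is closed, this agrees with the
  closure relative to \<open>S2\<close>.\<close>

definition tiling_cells :: "(real^3) set set \<Rightarrow> (real^3) set set" where
  "tiling_cells \<G> = closure ` components (S2 - \<Union>\<G>)"

definition cap_covering :: "real \<Rightarrow> (real^3) set set \<Rightarrow> bool" where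
  "cap_covering \<rho> \<C> \<longleftrightarrow> (\<forall>K\<in>\<C>. \<exists>x\<in>S2. K = spherical_cap x \<rho>) \<and> S2 \<subseteq> \<Union>\<C>"

definition TS_covering :: "real \<Rightarrow> (real^3) set set \<Rightarrow> bool" where
  "TS_covering \<rho> \<C> \<longleftrightarrow> cap_covering \<rho> \<C> \<and>
     (\<exists>\<G>. finite \<G> \<and> (\<forall>G\<in>\<G>. great_circle G) \<and>
       (\<exists>f. inj_on f (tiling_cells \<G>) \<and> (\<forall>Q\<in>tiling_cells \<G>. f Q \<in> \<C> \<and> Q \<subseteq> f Q)))"

text \<open>Surface area on the unit sphere as a cone measure: the solid cone from the origin over a
  region of area \<open>a\<close> has volume \<open>a / 3\<close>.  In particular the whole sphere has area
  \<open>3 \<cdot> (4/3) \<pi> = 4 \<pi>\<close>.\<close>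

definition Sarea :: "(real^3) set \<Rightarrow> real" where
  "Sarea A = 3 * measure lebesgue {t *\<^sub>R x | t x. 0 \<le> t \<and> t \<le> 1 \<and> x \<in> A}"

definition cap_density :: "(real^3) set set \<Rightarrow> real" where
  "cap_density \<C> = (\<Sum>K\<in>\<C>. Sarea K) / Sarea S2"

end

theory Submission imports Defs
begin

text \<open>Put \<open>C = cos \<rho>\<close> and let \<open>F\<close> be the number of cells of the tiling. Distinct cells lie in distinct
caps, and a cap has area \<open>2\<pi>(1 - C)\<close>, so it suffices to show that
\<open>4\<pi> \<le> F (8 arctan (1/C) - 2\<pi>)\<close>. The factor on the right is the area of the regular spherical
quadrilateral inscribed in a cap: it says that, on average, a cell is no larger than a square.
Two facts combine to give this.

The first is combinatorial: the cells have at most four sides on average (\<open>sum_side_count_le\<close>). The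
planes of the great circles are added one at a time. A new plane cuts a cell with \<open>s\<close> sides into
two cells with at most \<open>s + 4\<close> sides altogether, because it can cross at most two of the old sides
(\<open>side_count_cut\<close>). So every additional cell brings at most four additional sides, starting from the
single cell without sides that is the whole sphere.

The second is metric: a cell with \<open>s\<close> sides that lies in a cap of radius \<open>\<rho>\<close> has area at most
\<open>a s + 2\<pi> b\<close>, where \<open>a = side_weight C\<close> and \<open>b = angle_weight C\<close> are nonnegative constants
(\<open>cell_bound\<close>). One may take the center \<open>x\<close> of the cap inside the cell (\<open>recenter_cap\<close>). Joining \<open>x\<close>
to the vertices cuts the cell into triangles, one for each side, whose angles at \<open>x\<close> add up to at
most \<open>2\<pi>\<close>. A triangle with angle \<open>\<theta>\<close> at \<open>x\<close> is contained in the isosceles one with legs \<open>\<rho>\<close>, whose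
area \<open>\<theta> - 2 arctan (C tan (\<theta>/2))\<close> is a concave function of \<open>\<theta>\<close>, hence lies below its tangent
\<open>a + b \<theta>\<close> at \<open>\<theta> = \<pi>/2\<close> (\<open>excess_tangent\<close>). Summing over all cells bounds \<open>4\<pi>\<close> by \<open>(4a + 2\<pi> b) F\<close>, and
\<open>4a + 2\<pi> b\<close> is four times the value of the tangent at its point of contact, that is, the area of
the four isosceles triangles with a right angle at \<open>x\<close> that form the square.

Throughout, a region of the sphere is represented by the cone over it, and its area by the volume
that this cone cuts out of the unit ball. Angles never have to be measured as such: the angle of a
triangle at \<open>x\<close> enters as half the area of the wedge between two half-planes through the line of
\<open>x\<close>. Girard's formula turns the area of a triangle into areas of wedges, and the area of a wedge is
proportional to its angle because it is additive and invariant under rotation. The same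
proportionality also gives the lower bound for the area of a cap, by comparison with thin isosceles
triangles.\<close>

section \<open>Measure preliminaries and wedges of rotationally invariant solids\<close>

text \<open>The deviation \<open>g\<close> of \<open>f\<close> from the linear function with the same value at \<open>c\<close> is additive, and
vanishes at \<open>c\<close> and hence at \<open>c/2\<close>. So \<open>2 g t\<close> is again a value of \<open>g\<close>, at the point \<open>2 t\<close> reduced
modulo \<open>c\<close>. As \<open>g\<close> is bounded, iterating this doubling forces it to be zero.\<close>

lemma additive_nonneg_imp_linear:
  fixes f :: "real \<Rightarrow> real"
  assumes c: "c > 0"
    and add: "\<And>s t. 0 \<le> s \<Longrightarrow> 0 \<le> t \<Longrightarrow> s + t \<le> c \<Longrightarrow> f (s + t) = f s + f t"
    and nn: "\<And>t. 0 \<le> t \<Longrightarrow> t \<le> c \<Longrightarrow> 0 \<le> f t"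
    and t: "0 \<le> t" "t \<le> c"
  shows "f t = t / c * f c"
proof -
  define g where "g t = f t - t / c * f c" for t
  have gadd: "g (s + t) = g s + g t" if "0 \<le> s" "0 \<le> t" "s + t \<le> c" for s t
    using add[OF that] by (simp add: g_def algebra_simps add_divide_distrib)
  have gc: "g c = 0" using c by (simp add: g_def)
  have ghalf: "g (c / 2) = 0" using gadd[of "c/2" "c/2"] gc c by simp
  have mono: "f t \<le> f c" if "0 \<le> t" "t \<le> c" for t
    using add[of t "c - t"] nn[of "c - t"] that by simp
  have "\<bar>g t\<bar> \<le> f c / 2 ^ n" if "0 \<le> t" "t \<le> c" for t n
    using that
  proof (induction n arbitrary: t)
    case 0
    have "0 \<le> t / c" "t / c \<le> 1" using 0 c by (auto simp: field_simps)
    then have "0 \<le> t / c * f c" "t / c * f c \<le> 1 * f c"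
      using mult_right_mono[of 0 "t / c" "f c"] mult_right_mono[of "t / c" 1 "f c"] nn[of c] c by simp_all
    then show ?case using mono[OF 0] nn[OF 0] by (simp add: g_def abs_le_iff)
  next
    case (Suc n)
    define s where "s = (if t \<le> c / 2 then t else t - c / 2)"
    have s: "0 \<le> s" "2 * s \<le> c" using Suc.prems by (auto simp: s_def)
    have "g t = g s" using gadd[of "c/2" "t - c/2"] ghalf c Suc.prems by (auto simp: s_def)
    moreover have "2 * g s = g (2 * s)" using gadd[of s s] s by simp
    moreover have "\<bar>g (2 * s)\<bar> \<le> f c / 2 ^ n" using Suc.IH[of "2 * s"] s by simp
    ultimately have "2 * \<bar>g t\<bar> \<le> f c / 2 ^ n" by linarith
    then show ?case by (simp add: field_simps)
  qed
  then have bd: "\<bar>g t\<bar> \<le> f c / 2 ^ n" for n using t by blast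
  have "(\<lambda>n. f c / 2 ^ n) \<longlonglongrightarrow> 0" by real_asymp
  then have "\<bar>g t\<bar> \<le> 0" by (rule LIMSEQ_le_const) (use bd in auto)
  then show ?thesis by (simp add: g_def)
qed

lemma closed_in_lebesgue: "closed S \<Longrightarrow> S \<in> sets lebesgue"
  by (intro sets_completionI_sets) (simp add: borel_closed)

lemma measure_cong_outside:
  fixes A B :: "'a::euclidean_space set"
  assumes "A \<in> lmeasurable" "B \<in> lmeasurable" "negligible Z" "A - Z = B - Z"
  shows "measure lebesgue A = measure lebesgue B"
proof (rule measure_negligible_symdiff[symmetric])
  show "negligible (A - B \<union> (B - A))"
    by (rule negligible_subset[OF assms(3)]) (use assms(4) in blast)
qed (use assms in auto)

lemma measure_Un_disjoint:
  assumes "A \<in> lmeasurable" "B \<in> lmeasurable" "A \<inter> B = {}"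
  shows "measure lebesgue (A \<union> B) = measure lebesgue A + measure lebesgue B"
  using measure_Un3[OF assms(1,2)] assms(3) by simp

text \<open>The rotation by \<open>\<phi>\<close> in the plane of the orthonormal vectors \<open>e1\<close>, \<open>e2\<close>, which fixes the orthogonal
complement of that plane.\<close>

definition plane_rotation :: "real^3 \<Rightarrow> real^3 \<Rightarrow> real \<Rightarrow> real^3 \<Rightarrow> real^3" where
  "plane_rotation e1 e2 \<phi> y =
     y + ((cos \<phi> - 1) * (y \<bullet> e1) - sin \<phi> * (y \<bullet> e2)) *\<^sub>R e1
       + (sin \<phi> * (y \<bullet> e1) + (cos \<phi> - 1) * (y \<bullet> e2)) *\<^sub>R e2"

context
  fixes e1 e2 :: "real^3"
  assumes e1: "norm e1 = 1" and e2: "norm e2 = 1" and orth: "e1 \<bullet> e2 = 0"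
begin

lemma orthonormal_pair_dots: "e1 \<bullet> e1 = 1" "e2 \<bullet> e2 = 1" "e2 \<bullet> e1 = 0"
  using e1 e2 orth by (auto simp: norm_eq_1 inner_commute)

lemma plane_rotation_dot:
  "plane_rotation e1 e2 \<phi> y \<bullet> e1 = cos \<phi> * (y \<bullet> e1) - sin \<phi> * (y \<bullet> e2)"
  "plane_rotation e1 e2 \<phi> y \<bullet> e2 = sin \<phi> * (y \<bullet> e1) + cos \<phi> * (y \<bullet> e2)"
  by (simp_all add: plane_rotation_def inner_add_left orthonormal_pair_dots orth algebra_simps)

lemma plane_rotation_dot_axis:
  assumes "x \<bullet> e1 = 0" "x \<bullet> e2 = 0"
  shows "x \<bullet> plane_rotation e1 e2 \<phi> y = x \<bullet> y"
  by (simp add: plane_rotation_def inner_add_right assms)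

lemma orthogonal_plane_rotation: "orthogonal_transformation (plane_rotation e1 e2 \<phi>)"
proof -
  have lin: "linear (plane_rotation e1 e2 \<phi>)"
    by (rule linearI) (simp_all add: plane_rotation_def inner_add_left algebra_simps)
  have "norm (plane_rotation e1 e2 \<phi> y) = norm y" for y
  proof -
    define p q where "p = y \<bullet> e1" and "q = y \<bullet> e2"
    define P Q where "P = (cos \<phi> - 1) * p - sin \<phi> * q" and "Q = sin \<phi> * p + (cos \<phi> - 1) * q"
    have "plane_rotation e1 e2 \<phi> y \<bullet> plane_rotation e1 e2 \<phi> y
        = (y + P *\<^sub>R e1 + Q *\<^sub>R e2) \<bullet> (y + P *\<^sub>R e1 + Q *\<^sub>R e2)"
      by (simp add: plane_rotation_def P_def Q_def p_def q_def)
    also have "\<dots> = y \<bullet> y + 2 * P * p + 2 * Q * q + P\<^sup>2 + Q\<^sup>2"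
      by (simp add: inner_add_left inner_add_right orthonormal_pair_dots orth p_def q_def
          power2_eq_square inner_commute algebra_simps)
    also have "2 * P * p + 2 * Q * q + P\<^sup>2 + Q\<^sup>2 = (p\<^sup>2 + q\<^sup>2) * ((sin \<phi>)\<^sup>2 + (cos \<phi>)\<^sup>2 - 1)"
      unfolding P_def Q_def by algebra
    hence "y \<bullet> y + 2 * P * p + 2 * Q * q + P\<^sup>2 + Q\<^sup>2 = y \<bullet> y" by simp
    finally show ?thesis by (simp add: norm_eq)
  qed
  with lin show ?thesis by (simp add: orthogonal_transformation)
qed

text \<open>The assumption on \<open>X\<close> expresses invariance under the rotations about an axis \<open>x\<close>; for \<open>x = 0\<close> it says
that \<open>X\<close> is invariant under all rotations. As a function of \<open>\<phi>\<close>, the measure of the part of \<open>X\<close> in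
the first half-space but outside the second, a wedge of angle \<open>\<phi>\<close>, is additive, so it is linear;
and a half turn exchanges the two halves of \<open>X\<close>, so its value at \<open>pi\<close> is half the measure of \<open>X\<close>.\<close>

lemma measure_invariant_wedge:
  assumes X: "X \<in> lmeasurable"
    and inv: "\<And>y z. norm y = norm z \<Longrightarrow> x \<bullet> y = x \<bullet> z \<Longrightarrow> y \<in> X \<longleftrightarrow> z \<in> X"
    and x: "x \<bullet> e1 = 0" "x \<bullet> e2 = 0"
    and \<phi>: "0 \<le> \<phi>" "\<phi> \<le> pi"
  shows "measure lebesgue (X \<inter> {y. 0 \<le> e1 \<bullet> y \<and> 0 \<le> (cos \<phi> *\<^sub>R e1 + sin \<phi> *\<^sub>R e2) \<bullet> y})
       = (1/2 - \<phi> / (2*pi)) * measure lebesgue X"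
proof -
  define n where "n \<psi> = cos \<psi> *\<^sub>R e1 + sin \<psi> *\<^sub>R e2" for \<psi>
  define H where "H \<psi> = {y. 0 \<le> n \<psi> \<bullet> y}" for \<psi>
  define R where "R \<psi> = plane_rotation e1 e2 \<psi>" for \<psi>
  define M where "M \<psi> = measure lebesgue (X \<inter> (H 0 - H \<psi>))" for \<psi>
  have n0: "n 0 = e1" and npi: "n pi = - e1" by (simp_all add: n_def)
  have neg: "negligible {y. e1 \<bullet> y = 0}"
    using e1 by (intro negligible_hyperplane) auto
  have Hm: "H \<psi> \<in> sets lebesgue" for \<psi>
    unfolding H_def by (rule closed_in_lebesgue) (intro closed_Collect_le continuous_intros)
  have XH: "X \<inter> (H \<psi> - H \<psi>') \<in> lmeasurable" "X \<inter> H \<psi> \<in> lmeasurable" for \<psi> \<psi>'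
    using X Hm by (auto intro!: fmeasurable_Int_fmeasurable)
  have nR: "n (\<psi> + \<psi>') \<bullet> R \<psi> y = n \<psi>' \<bullet> y" for \<psi> \<psi>' y
  proof -
    have "n (\<psi> + \<psi>') \<bullet> R \<psi> y = cos (\<psi> + \<psi>') * (R \<psi> y \<bullet> e1) + sin (\<psi> + \<psi>') * (R \<psi> y \<bullet> e2)"
      by (simp add: n_def inner_add_left inner_commute[of "R \<psi> y"])
    also have "\<dots> = (cos \<psi>' * (y \<bullet> e1) + sin \<psi>' * (y \<bullet> e2)) * ((sin \<psi>)\<^sup>2 + (cos \<psi>)\<^sup>2)"
      unfolding R_def plane_rotation_dot cos_add sin_add by algebra
    finally show ?thesis by (simp add: n_def inner_add_left inner_commute[of y])
  qed
  have RX: "R \<psi> y \<in> X \<longleftrightarrow> y \<in> X" for \<psi> y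
    using orthogonal_plane_rotation[of \<psi>] plane_rotation_dot_axis[OF x, of \<psi> y] inv[of "R \<psi> y" y]
    by (auto simp: R_def orthogonal_transformation)
  have surjR: "\<exists>z. y = R \<psi> z" for \<psi> y
    using orthogonal_transformation_surj[OF orthogonal_plane_rotation[of \<psi>]] unfolding R_def by (metis surjD)
  \<comment> \<open>Here \<open>P\<close> is any condition on the position of \<open>y\<close> relative to all the half-planes; a rotation
    shifts the angles in it.\<close>
  have img: "R \<psi> ` {y \<in> X. P (\<lambda>\<psi>'. n \<psi>' \<bullet> y)} = {y \<in> X. P (\<lambda>\<psi>'. n (\<psi> + \<psi>') \<bullet> y)}" for \<psi> P
  proof (intro set_eqI iffI)
    fix y assume "y \<in> {y \<in> X. P (\<lambda>\<psi>'. n (\<psi> + \<psi>') \<bullet> y)}"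
    moreover obtain z where "y = R \<psi> z" using surjR by blast
    ultimately show "y \<in> R \<psi> ` {y \<in> X. P (\<lambda>\<psi>'. n \<psi>' \<bullet> y)}" by (auto simp: nR RX)
  qed (auto simp: nR RX)
  have mR: "measure lebesgue {y \<in> X. P (\<lambda>\<psi>'. n (\<psi> + \<psi>') \<bullet> y)}
      = measure lebesgue {y \<in> X. P (\<lambda>\<psi>'. n \<psi>' \<bullet> y)}" if "{y \<in> X. P (\<lambda>\<psi>'. n \<psi>' \<bullet> y)} \<in> lmeasurable" for \<psi> P
    unfolding img[symmetric]
    using measure_orthogonal_image[OF orthogonal_plane_rotation[of \<psi>] that] by (simp add: R_def)
  \<comment> \<open>For \<open>s + t = pi\<close> the two parts fit together only up to the boundary plane of \<open>H 0\<close>.\<close>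
  have Madd: "M (s + t) = M s + M t" if st: "0 \<le> s" "0 \<le> t" "s + t \<le> pi" for s t
  proof -
    consider "s + t = 0" | "s + t = pi" | "s + t \<noteq> 0" "s + t \<noteq> pi" by blast
    then show ?thesis
    proof cases
      case 3
      then have pos: "0 < sin (s + t)" using st by (intro sin_gt_zero) auto
      \<comment> \<open>The normal at the intermediate angle \<open>s\<close> is a nonnegative combination of those at \<open>0\<close> and \<open>s + t\<close>.\<close>
      have comb: "sin (s + t) * (n s \<bullet> y) = sin t * (n 0 \<bullet> y) + sin s * (n (s + t) \<bullet> y)" for y
      proof -
        have "sin s = sin (s + t) * cos t - cos (s + t) * sin t" using sin_diff[of "s+t" t] by simp
        moreover have "cos s = cos (s + t) * cos t + sin (s + t) * sin t" using cos_diff[of "s+t" t] by simp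
        ultimately have "sin (s + t) * (cos s * (e1 \<bullet> y) + sin s * (e2 \<bullet> y))
          = sin t * (e1 \<bullet> y) * ((sin (s+t))\<^sup>2 + (cos (s+t))\<^sup>2) + sin s * (cos (s+t) * (e1 \<bullet> y) + sin (s+t) * (e2 \<bullet> y))"
          by algebra
        then show ?thesis by (simp add: n_def inner_add_left)
      qed
      have s0: "0 \<le> sin s" "0 \<le> sin t" using st by (auto intro!: sin_ge_zero)
      have both: "y \<in> H s" if "y \<in> H 0" "y \<in> H (s + t)" for y
      proof -
        have "0 \<le> sin (s + t) * (n s \<bullet> y)" unfolding comb using that s0 by (simp add: H_def)
        then show ?thesis using pos by (simp add: H_def zero_le_mult_iff)
      qed
      have neither: "y \<notin> H s" if "y \<notin> H 0" "y \<notin> H (s + t)" for y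
      proof
        assume "y \<in> H s"
        have "0 < sin s \<or> 0 < sin t"
          using pos s0 by (auto simp: sin_add le_less)
        moreover have "sin s * (n (s + t) \<bullet> y) \<le> 0" "sin t * (n 0 \<bullet> y) \<le> 0"
          using that s0 by (auto simp: H_def mult_le_0_iff)
        moreover have "0 \<le> sin (s + t) * (n s \<bullet> y)" using \<open>y \<in> H s\<close> pos by (simp add: H_def)
        ultimately show False using that unfolding comb H_def
          by (smt (verit) mem_Collect_eq mult_pos_neg)
      qed
      have "X \<inter> (H 0 - H (s + t)) = (X \<inter> (H 0 - H s)) \<union> (X \<inter> (H s - H (s + t)))"
        using both neither by blast
      then have "M (s + t) = M s + measure lebesgue (X \<inter> (H s - H (s + t)))"
        unfolding M_def by (simp only:) (rule measure_Un_disjoint, auto simp: XH)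
      also have "measure lebesgue (X \<inter> (H s - H (s + t))) = M t"
      proof -
        have "X \<inter> (H \<psi> - H \<psi>') = {y \<in> X. 0 \<le> n \<psi> \<bullet> y \<and> \<not> 0 \<le> n \<psi>' \<bullet> y}" for \<psi> \<psi>' by (auto simp: H_def)
        then show ?thesis unfolding M_def
          using mR[of "\<lambda>f. 0 \<le> f 0 \<and> \<not> 0 \<le> f t" s] XH(1)[of 0 t] by simp
      qed
      finally show ?thesis .
    next
      case 1
      then have "s = 0" "t = 0" using st by auto
      then show ?thesis by (simp add: M_def)
    next
      case 2
      have "X \<inter> (H s - H pi) = {y \<in> X. 0 \<le> n s \<bullet> y \<and> \<not> 0 \<le> n pi \<bullet> y}"
        and "X \<inter> (H 0 - H t) = {y \<in> X. 0 \<le> n 0 \<bullet> y \<and> \<not> 0 \<le> n t \<bullet> y}" by (auto simp: H_def)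
      then have Mt: "measure lebesgue (X \<inter> (H s - H pi)) = M t" unfolding M_def
        using mR[of "\<lambda>f. 0 \<le> f 0 \<and> \<not> 0 \<le> f t" s] XH(1)[of 0 t] 2 by simp
      have disj: "M s + M t = measure lebesgue ((X \<inter> (H 0 - H s)) \<union> (X \<inter> (H s - H pi)))"
        unfolding Mt[symmetric] unfolding M_def[of s]
        by (rule measure_Un_disjoint[symmetric]) (auto simp: XH)
      show ?thesis unfolding disj unfolding 2 M_def[of pi]
      proof (rule measure_cong_outside)
        show "negligible {y. e1 \<bullet> y = 0}" by (rule neg)
        show "X \<inter> (H 0 - H pi) - {y. e1 \<bullet> y = 0} =
          X \<inter> (H 0 - H s) \<union> X \<inter> (H s - H pi) - {y. e1 \<bullet> y = 0}"
          by (auto simp: H_def n0 npi)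
      qed (intro fmeasurable.Un XH)+
    qed
  qed
  have Mnn: "0 \<le> M t" for t by (simp add: M_def)
  have XP: "{y \<in> X. 0 < n 0 \<bullet> y} \<in> lmeasurable"
  proof -
    have "{y \<in> X. 0 < n 0 \<bullet> y} = X \<inter> (H 0 - H pi)" by (auto simp: H_def n0 npi)
    then show ?thesis using XH by simp
  qed
  have XN: "{y \<in> X. 0 < n pi \<bullet> y} \<in> lmeasurable"
  proof -
    have "{y \<in> X. 0 < n pi \<bullet> y} = X \<inter> (H pi - H 0)" by (auto simp: H_def n0 npi)
    then show ?thesis using XH by simp
  qed
  have Mpi: "M pi = measure lebesgue {y \<in> X. 0 < n 0 \<bullet> y}"
    unfolding M_def by (rule arg_cong[where f = "measure lebesgue"]) (auto simp: H_def n0 npi)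
  have "measure lebesgue X = measure lebesgue ({y \<in> X. 0 < n 0 \<bullet> y} \<union> {y \<in> X. 0 < n pi \<bullet> y})"
    by (rule measure_cong_outside[OF _ _ neg]) (use X XP XN in \<open>auto simp: n0 npi intro!: fmeasurable.Un\<close>)
  also have "\<dots> = measure lebesgue {y \<in> X. 0 < n 0 \<bullet> y} + measure lebesgue {y \<in> X. 0 < n pi \<bullet> y}"
  proof -
    have "{y \<in> X. 0 < n 0 \<bullet> y} \<inter> {y \<in> X. 0 < n pi \<bullet> y} = {}" by (auto simp: n0 npi)
    then show ?thesis by (simp add: measure_Un_disjoint XP XN)
  qed
  also have "measure lebesgue {y \<in> X. 0 < n pi \<bullet> y} = measure lebesgue {y \<in> X. 0 < n 0 \<bullet> y}"
    using mR[of "\<lambda>f. 0 < f 0" pi] XP by simp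
  finally have half: "measure lebesgue X = 2 * M pi" by (simp add: Mpi)
  have "measure lebesgue (X \<inter> H 0) = M pi"
    unfolding M_def by (rule measure_cong_outside[OF XH(2,1) neg]) (auto simp: H_def n0 npi)
  moreover have "measure lebesgue (X \<inter> H 0) = M \<phi> + measure lebesgue (X \<inter> H 0 \<inter> H \<phi>)"
  proof -
    have "X \<inter> H 0 = X \<inter> (H 0 - H \<phi>) \<union> X \<inter> H 0 \<inter> H \<phi>" by blast
    moreover have "X \<inter> H 0 \<inter> H \<phi> \<in> lmeasurable"
      using XH(2)[of 0] Hm[of \<phi>] by (rule fmeasurable_Int_fmeasurable)
    moreover have "X \<inter> (H 0 - H \<phi>) \<inter> (X \<inter> H 0 \<inter> H \<phi>) = {}" by blast
    ultimately show ?thesis unfolding M_def by (metis measure_Un_disjoint XH(1))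
  qed
  moreover have "M \<phi> = \<phi> / pi * M pi"
    by (rule additive_nonneg_imp_linear) (use Madd Mnn \<phi> in auto)
  moreover have "X \<inter> {y. 0 \<le> e1 \<bullet> y \<and> 0 \<le> (cos \<phi> *\<^sub>R e1 + sin \<phi> *\<^sub>R e2) \<bullet> y} = X \<inter> H 0 \<inter> H \<phi>"
    by (auto simp: H_def n0) (auto simp: n_def)
  ultimately show ?thesis using half by (simp add: field_simps)
qed

end

section \<open>Solid angles of cones: lunes and triangles\<close>

text \<open>The closed convex cone of all vectors that form no obtuse angle with an element of \<open>N\<close>. For finite
\<open>N\<close> this is a polyhedral cone given by its inner normals, the cone over a spherical polygon.\<close>

definition dual_cone :: "(real^3) set \<Rightarrow> (real^3) set" where
  "dual_cone N = {y. \<forall>n\<in>N. 0 \<le> n \<bullet> y}"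

text \<open>For a cone \<open>A\<close> this is the area of the part of the sphere inside \<open>A\<close>.\<close>

definition solid_angle :: "(real^3) set \<Rightarrow> real" where
  "solid_angle A = 3 * measure lebesgue (A \<inter> cball 0 1)"

lemma closed_dual_cone [simp]: "closed (dual_cone N)"
  unfolding dual_cone_def Collect_ball_eq by (auto intro!: closed_INT closed_Collect_le continuous_intros)

lemma convex_dual_cone [simp]: "convex (dual_cone N)"
  unfolding convex_def dual_cone_def by (auto simp: inner_add_right)

lemma dual_cone_add: "y \<in> dual_cone N \<Longrightarrow> z \<in> dual_cone N \<Longrightarrow> y + z \<in> dual_cone N"
  by (auto simp: dual_cone_def inner_add_right)

lemma dual_cone_scaleR: "y \<in> dual_cone N \<Longrightarrow> 0 \<le> c \<Longrightarrow> c *\<^sub>R y \<in> dual_cone N"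
  by (auto simp: dual_cone_def)

lemma dual_cone_insert: "dual_cone (insert n N) = dual_cone N \<inter> {y. 0 \<le> n \<bullet> y}"
  by (auto simp: dual_cone_def)

lemma zero_in_dual_cone [simp]: "0 \<in> dual_cone N"
  by (auto simp: dual_cone_def)

lemma lmeasurable_Int_cball:
  fixes A :: "(real^3) set"
  assumes "closed A" shows "A \<inter> cball 0 1 \<in> lmeasurable"
  by (intro lmeasurable_compact closed_Int_compact assms compact_cball)

lemma solid_angle_nonneg [simp]: "0 \<le> solid_angle A"
  by (simp add: solid_angle_def)

lemma solid_angle_mono:
  assumes "closed A" "closed B" "A \<subseteq> B" shows "solid_angle A \<le> solid_angle B"
  unfolding solid_angle_def
  using measure_mono_fmeasurable[OF _ fmeasurableD lmeasurable_Int_cball, of "A \<inter> cball 0 1" B]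
    lmeasurable_Int_cball[OF assms(1)] assms by auto

lemma solid_angle_negligible:
  assumes "negligible A" shows "solid_angle A = 0"
  unfolding solid_angle_def using negligible_Int[of A "cball 0 1"] assms
  by (simp add: negligible_imp_measure0)

lemma solid_angle_planar:
  assumes "K \<subseteq> span {a, b}" shows "solid_angle K = 0"
proof -
  have "dim (span {a, b}) \<le> card {a, b}" unfolding dim_span by (rule dim_le_card') simp
  also have "\<dots> < DIM(real^3)" by (simp add: card_insert_if)
  finally have "negligible (span {a, b})" by (intro negligible_lowdim) simp
  then show ?thesis using assms by (intro solid_angle_negligible) (rule negligible_subset)
qed

lemma measure_unit_ball: "3 * measure lebesgue (cball 0 1 :: (real^3) set) = 4 * pi"
  by (simp add: content_cball unit_ball_vol_3)

lemma sum_solid_angle_le_sphere: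
  assumes "finite I" "\<And>i. i \<in> I \<Longrightarrow> closed (A i)"
    and "\<And>i j. i \<in> I \<Longrightarrow> j \<in> I \<Longrightarrow> i \<noteq> j \<Longrightarrow> negligible (A i \<inter> A j)"
  shows "(\<Sum>i\<in>I. solid_angle (A i)) \<le> 4 * pi"
proof -
  have "measure lebesgue (\<Union> ((\<lambda>i. A i \<inter> cball 0 1) ` I)) = (\<Sum>i\<in>I. measure lebesgue (A i \<inter> cball 0 1))"
  proof (rule measure_negligible_finite_Union_image)
    show "pairwise (\<lambda>i j. negligible (A i \<inter> cball 0 1 \<inter> (A j \<inter> cball 0 1))) I"
      unfolding pairwise_def using assms(3) by (auto intro: negligible_subset)
  qed (use assms in \<open>auto intro: lmeasurable_Int_cball\<close>)
  moreover have "measure lebesgue (\<Union> ((\<lambda>i. A i \<inter> cball 0 1) ` I)) \<le> measure lebesgue (cball 0 1 :: (real^3) set)"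
    using assms by (intro measure_mono_fmeasurable fmeasurableD fmeasurable.finite_UN) (auto intro: lmeasurable_Int_cball)
  ultimately show ?thesis
    unfolding solid_angle_def sum_distrib_left[symmetric] using measure_unit_ball by linarith
qed

lemma solid_angle_subadditive:
  assumes "finite I" "\<And>i. i \<in> I \<Longrightarrow> closed (A i)" "negligible Z" "K \<subseteq> (\<Union>i\<in>I. A i) \<union> Z" "closed K"
  shows "solid_angle K \<le> (\<Sum>i\<in>I. solid_angle (A i))"
proof -
  let ?B = "\<Union>i\<in>I. A i \<inter> cball 0 1"
  have B: "?B \<in> lmeasurable" using assms by (intro fmeasurable.finite_UN) (auto intro: lmeasurable_Int_cball)
  have "measure lebesgue (K \<inter> cball 0 1) \<le> measure lebesgue (?B \<union> Z)"
    using assms B by (intro measure_mono_fmeasurable fmeasurableD fmeasurable.Un lmeasurable_Int_cball)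
       (auto intro: negligible_imp_measurable)
  also have "\<dots> = measure lebesgue ?B"
    by (rule measure_cong_outside[OF _ B assms(3)]) (use B fmeasurable.Un[OF B negligible_imp_measurable[OF assms(3)]] in auto)
  also have "\<dots> \<le> (\<Sum>i\<in>I. measure lebesgue (A i \<inter> cball 0 1))"
    using assms by (intro measure_UNION_le) (auto intro: lmeasurable_Int_cball fmeasurableD)
  finally show ?thesis unfolding solid_angle_def sum_distrib_left[symmetric] by simp
qed

lemma Sarea_cone:
  assumes scale: "\<And>y c. y \<in> A \<Longrightarrow> 0 \<le> c \<Longrightarrow> c *\<^sub>R y \<in> A"
  shows "Sarea (A \<inter> S2) = solid_angle A"
proof (cases "A \<subseteq> {0}")
  case True
  have "negligible A" using True by (rule negligible_subset[rotated]) simp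
  moreover have "A \<inter> S2 = {}" using True by auto
  ultimately show ?thesis by (simp add: Sarea_def solid_angle_negligible)
next
  case False
  then obtain a where a: "a \<in> A" "a \<noteq> 0" by blast
  have "{t *\<^sub>R x |t x. 0 \<le> t \<and> t \<le> 1 \<and> x \<in> A \<inter> S2} = A \<inter> cball 0 1"
  proof (intro set_eqI iffI)
    fix y assume y: "y \<in> A \<inter> cball 0 1"
    show "y \<in> {t *\<^sub>R x |t x. 0 \<le> t \<and> t \<le> 1 \<and> x \<in> A \<inter> S2}"
    proof (cases "y = 0")
      case True
      have "(1 / norm a) *\<^sub>R a \<in> A \<inter> S2" using a scale[of a "1 / norm a"] by simp
      then show ?thesis using True by (intro CollectI exI[of _ 0] exI[of _ "(1 / norm a) *\<^sub>R a"]) auto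
    next
      case False
      have "(1 / norm y) *\<^sub>R y \<in> A \<inter> S2" using False y scale[of y "1 / norm y"] by simp
      moreover have "y = norm y *\<^sub>R ((1 / norm y) *\<^sub>R y)" using False by simp
      ultimately show ?thesis using y by (intro CollectI exI[of _ "norm y"] exI[of _ "(1 / norm y) *\<^sub>R y"]) auto
    qed
  qed (auto intro!: scale mult_le_one)
  then show ?thesis by (simp add: Sarea_def solid_angle_def)
qed

lemma Sarea_S2: "Sarea S2 = 4 * pi"
  using Sarea_cone[of UNIV] measure_unit_ball by (simp add: solid_angle_def)

text \<open>Polar form of \<open>n2\<close> relative to \<open>n1\<close>. The orthogonal vector \<open>e2\<close> is unique unless \<open>n2\<close> is \<open>n1\<close> or
\<open>-n1\<close>, when any choice will do.\<close>

lemma unit_vector_in_plane: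
  fixes n1 n2 :: "real^3"
  assumes "norm n1 = 1" "norm n2 = 1"
  obtains e2 where "norm e2 = 1" "n1 \<bullet> e2 = 0"
    "n2 = cos (arccos (n1 \<bullet> n2)) *\<^sub>R n1 + sin (arccos (n1 \<bullet> n2)) *\<^sub>R e2"
proof -
  define c where "c = n1 \<bullet> n2"
  define p where "p = n2 - c *\<^sub>R n1"
  have c: "-1 \<le> c" "c \<le> 1" using Cauchy_Schwarz_ineq2[of n1 n2] assms by (auto simp: c_def)
  have d: "n1 \<bullet> n1 = 1" "n2 \<bullet> n2 = 1" using assms by (simp_all add: norm_eq_1)
  have p1: "n1 \<bullet> p = 0" by (simp add: p_def c_def inner_diff_right d)
  have "p \<bullet> p = 1 - c\<^sup>2"
    by (simp add: p_def c_def inner_diff_right inner_diff_left d inner_commute power2_eq_square)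
  then have np: "norm p = sqrt (1 - c\<^sup>2)" by (simp add: norm_eq_sqrt_inner)
  have cs: "cos (arccos c) = c" "sin (arccos c) = sqrt (1 - c\<^sup>2)" using c by (auto simp: sin_arccos_abs)
  show ?thesis
  proof (cases "p = 0")
    case False
    show ?thesis
      by (rule that[of "(1 / norm p) *\<^sub>R p"])
        (use False p1 in \<open>simp_all add: cs np[symmetric] c_def[symmetric] p_def\<close>)
  next
    case True
    obtain q where q: "q \<noteq> 0" "orthogonal n1 q"
      using orthogonal_to_vector_exists[of n1] by auto
    show ?thesis
      by (rule that[of "(1 / norm q) *\<^sub>R q"])
        (use q True np in \<open>simp_all add: cs np[symmetric] c_def[symmetric] orthogonal_def, simp add: p_def\<close>)
  qed
qed

lemma solid_angle_lune:
  assumes "norm n1 = 1" "norm n2 = 1"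
  shows "solid_angle (dual_cone {n1, n2}) = 2 * (pi - arccos (n1 \<bullet> n2))"
proof -
  define \<phi> where "\<phi> = arccos (n1 \<bullet> n2)"
  obtain e2 where e2: "norm e2 = 1" "n1 \<bullet> e2 = 0" "n2 = cos \<phi> *\<^sub>R n1 + sin \<phi> *\<^sub>R e2"
    using unit_vector_in_plane[OF assms] unfolding \<phi>_def by blast
  have \<phi>: "0 \<le> \<phi>" "\<phi> \<le> pi"
    using Cauchy_Schwarz_ineq2[of n1 n2] assms by (auto simp: \<phi>_def intro!: arccos_lbound arccos_ubound)
  have "measure lebesgue (cball 0 1 \<inter> {y. 0 \<le> n1 \<bullet> y \<and> 0 \<le> (cos \<phi> *\<^sub>R n1 + sin \<phi> *\<^sub>R e2) \<bullet> y})
      = (1/2 - \<phi> / (2*pi)) * measure lebesgue (cball 0 1 :: (real^3) set)"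
    by (rule measure_invariant_wedge[OF assms(1) e2(1,2), where x = 0]) (use \<phi> in auto)
  also have "{y. 0 \<le> n1 \<bullet> y \<and> 0 \<le> (cos \<phi> *\<^sub>R n1 + sin \<phi> *\<^sub>R e2) \<bullet> y} = dual_cone {n1, n2}"
    unfolding e2(3)[symmetric] by (simp add: dual_cone_def)
  finally have "solid_angle (dual_cone {n1, n2}) = (1/2 - \<phi> / (2*pi)) * (3 * measure lebesgue (cball 0 1 :: (real^3) set))"
    by (simp add: solid_angle_def Int_commute)
  also have "\<dots> = 2 * (pi - \<phi>)" unfolding measure_unit_ball by (simp add: field_simps)
  finally show ?thesis by (simp add: \<phi>_def)
qed

lemma solid_angle_uminus: "solid_angle (dual_cone (uminus ` N)) = solid_angle (dual_cone N)"
proof -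
  have orth: "orthogonal_transformation (uminus :: real^3 \<Rightarrow> real^3)"
    by (rule orthogonal_transformation_neg[THEN iffD2, of id, simplified id_def]) (simp add: orthogonal_transformation_id[unfolded id_def])
  have "dual_cone (uminus ` N) \<inter> cball 0 1 = uminus ` (dual_cone N \<inter> cball 0 1)"
  proof (intro set_eqI iffI)
    fix y assume "y \<in> dual_cone (uminus ` N) \<inter> cball 0 1"
    then have "- y \<in> dual_cone N \<inter> cball 0 1" by (auto simp: dual_cone_def)
    then show "y \<in> uminus ` (dual_cone N \<inter> cball 0 1)" by (rule rev_image_eqI) simp
  qed (auto simp: dual_cone_def)
  then show ?thesis unfolding solid_angle_def
    using measure_orthogonal_image[OF orth lmeasurable_Int_cball[OF closed_dual_cone[of N]]] by simp
qed

lemma solid_angle_split: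
  assumes "n \<noteq> 0"
  shows "solid_angle (dual_cone N) = solid_angle (dual_cone (insert n N)) + solid_angle (dual_cone (insert (-n) N))"
proof -
  let ?A = "dual_cone (insert n N) \<inter> cball 0 1" and ?B = "dual_cone (insert (-n) N) \<inter> cball 0 1"
  have "dual_cone N \<inter> cball 0 1 = ?A \<union> ?B" by (auto simp: dual_cone_def)
  moreover have "negligible (?A \<inter> ?B)"
    by (rule negligible_subset[OF negligible_hyperplane[of n 0]]) (use assms in \<open>auto simp: dual_cone_def\<close>)
  ultimately show ?thesis unfolding solid_angle_def
    using measure_Un3[of ?A lebesgue ?B] negligible_imp_measure0[of "?A \<inter> ?B"] by (simp add: lmeasurable_Int_cball)
qed

text \<open>Girard's formula. The angle of the lune with normals \<open>a\<close>, \<open>b\<close> is \<open>pi - arccos (a \<bullet> b)\<close>. The three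
planes divide space into eight octants; opposite octants have equal solid angle. Each of the three
lunes consists of the triangle and one neighbouring octant, and these four octants represent the
four pairs, so together they make up half the sphere.\<close>

lemma solid_angle_triangle:
  assumes n: "norm n1 = 1" "norm n2 = 1" "norm n3 = 1"
  shows "solid_angle (dual_cone {n1, n2, n3}) =
    2 * pi - arccos (n1 \<bullet> n2) - arccos (n2 \<bullet> n3) - arccos (n1 \<bullet> n3)"
proof -
  have nz: "n1 \<noteq> 0" "n2 \<noteq> 0" "n3 \<noteq> 0" using n by auto
  define t where "t a b c = solid_angle (dual_cone {a, b, c})" for a b c
  have u: "t (-a) (-b) (-c) = t a b c" for a b c
    using solid_angle_uminus[of "{a,b,c}"] by (simp add: t_def)
  have s: "solid_angle (dual_cone {n1, n2}) = t n1 n2 n3 + t n1 n2 (-n3)"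
     "solid_angle (dual_cone {n1, n3}) = t n1 n2 n3 + t n1 (-n2) n3"
     "solid_angle (dual_cone {n2, n3}) = t n1 n2 n3 + t (-n1) n2 n3"
    using solid_angle_split[OF nz(3), of "{n1,n2}"] solid_angle_split[OF nz(2), of "{n1,n3}"]
      solid_angle_split[OF nz(1), of "{n2,n3}"] by (auto simp: t_def insert_commute)
  have "dual_cone {} = UNIV" by (simp add: dual_cone_def)
  then have "solid_angle (dual_cone {}) = 4 * pi" using measure_unit_ball by (simp add: solid_angle_def)
  then have "4 * pi = solid_angle (dual_cone {n1,n2}) + solid_angle (dual_cone {n1,-n2})
    + (solid_angle (dual_cone {-n1,n2}) + solid_angle (dual_cone {-n1,-n2}))"
    using solid_angle_split[OF nz(1), of "{}"] solid_angle_split[OF nz(2), of "{n1}"]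
      solid_angle_split[OF nz(2), of "{-n1}"] by (simp add: insert_commute)
  also have "\<dots> = t n1 n2 n3 + t n1 n2 (-n3) + (t n1 (-n2) n3 + t n1 (-n2) (-n3))
    + (t (-n1) n2 n3 + t (-n1) n2 (-n3) + (t (-n1) (-n2) n3 + t (-n1) (-n2) (-n3)))"
    using solid_angle_split[OF nz(3), of "{n1,n2}"] solid_angle_split[OF nz(3), of "{n1,-n2}"]
      solid_angle_split[OF nz(3), of "{-n1,n2}"] solid_angle_split[OF nz(3), of "{-n1,-n2}"]
    by (simp add: t_def insert_commute)
  finally have "2 * pi = t n1 n2 n3 + t n1 n2 (-n3) + t n1 (-n2) n3 + t (-n1) n2 n3"
    using u[of n1 n2 n3] u[of n1 n2 "-n3"] u[of n1 "-n2" n3] u[of "-n1" n2 n3] by simp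
  then show ?thesis using s solid_angle_lune[OF n(1,2)] solid_angle_lune[OF n(1,3)] solid_angle_lune[OF n(2,3)]
    by (simp add: t_def)
qed

section \<open>Isosceles triangles and spherical caps\<close>

lemma frame_expansion:
  fixes x u u' y :: "real^3"
  assumes "norm x = 1" "norm u = 1" "norm u' = 1" "x \<bullet> u = 0" "x \<bullet> u' = 0" "u \<bullet> u' = 0"
  shows "y = (x \<bullet> y) *\<^sub>R x + (u \<bullet> y) *\<^sub>R u + (u' \<bullet> y) *\<^sub>R u'"
    and "y \<bullet> y = (x \<bullet> y)\<^sup>2 + (u \<bullet> y)\<^sup>2 + (u' \<bullet> y)\<^sup>2"
proof -
  have d: "x \<bullet> x = 1" "u \<bullet> u = 1" "u' \<bullet> u' = 1" "u \<bullet> x = 0" "u' \<bullet> x = 0" "u' \<bullet> u = 0"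
    using assms by (auto simp: norm_eq_1 inner_commute)
  have ne: "x \<noteq> u" "x \<noteq> u'" "u \<noteq> u'" using d assms(4-6) by auto
  have po: "pairwise orthogonal {x, u, u'}"
    using d assms(4-6) by (auto simp: pairwise_insert orthogonal_def)
  have "independent {x, u, u'}"
    by (rule pairwise_orthogonal_independent[OF po]) (use assms in auto)
  moreover have "card {x, u, u'} = 3" using ne by simp
  ultimately have "span {x, u, u'} = UNIV"
    by (intro dim_eq_full[THEN iffD1]) (simp add: dim_eq_card_independent)
  then have "y \<in> span {x, u, u'}" by simp
  then obtain a b c where y: "y = a *\<^sub>R x + b *\<^sub>R u + c *\<^sub>R u'"
    by (auto simp: span_insert span_empty algebra_simps)
  have "x \<bullet> y = a" "u \<bullet> y = b" "u' \<bullet> y = c"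
    by (simp_all add: y inner_add_right d assms)
  then show "y = (x \<bullet> y) *\<^sub>R x + (u \<bullet> y) *\<^sub>R u + (u' \<bullet> y) *\<^sub>R u'" using y by simp
  show "y \<bullet> y = (x \<bullet> y)\<^sup>2 + (u \<bullet> y)\<^sup>2 + (u' \<bullet> y)\<^sup>2"
    unfolding \<open>x \<bullet> y = a\<close> \<open>u \<bullet> y = b\<close> \<open>u' \<bullet> y = c\<close>
    by (simp add: y inner_add_left inner_add_right d assms(4-6) power2_eq_square)
qed

text \<open>The area of an isosceles spherical triangle with apex angle \<open>2\<eta>\<close> and legs of length \<open>arccos C\<close>:
its base angles are \<open>pi/2 - arctan (C * tan \<eta>)\<close>, and the area is the angle sum minus \<open>pi\<close>.\<close>

definition excess :: "real \<Rightarrow> real \<Rightarrow> real" where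
  "excess C \<eta> = 2 * (\<eta> - arctan (C * tan \<eta>))"

text \<open>The wedge of dihedral angle \<open>2\<eta>\<close> whose edge is orthogonal to \<open>u\<close> and \<open>u'\<close>, and which is symmetric
about the direction \<open>u\<close>.\<close>

definition wedge :: "real^3 \<Rightarrow> real^3 \<Rightarrow> real \<Rightarrow> (real^3) set" where
  "wedge u u' \<eta> = dual_cone {sin \<eta> *\<^sub>R u - cos \<eta> *\<^sub>R u', sin \<eta> *\<^sub>R u + cos \<eta> *\<^sub>R u'}"

text \<open>The cone over the isosceles triangle with apex \<open>x\<close>, apex angle \<open>2\<eta>\<close> bisected by the direction \<open>u\<close>,
and legs of length \<open>arccos C\<close>. The vector \<open>sqrt (1 - C\<^sup>2) * cos \<eta> * x - C * u\<close> is normal to the plane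
through the two base vertices.\<close>

definition triangle :: "real \<Rightarrow> real^3 \<Rightarrow> real^3 \<Rightarrow> real^3 \<Rightarrow> real \<Rightarrow> (real^3) set" where
  "triangle C x u u' \<eta> = wedge u u' \<eta> \<inter> {y. C * (u \<bullet> y) \<le> sqrt (1 - C\<^sup>2) * cos \<eta> * (x \<bullet> y)}"

lemma mem_wedge:
  "y \<in> wedge u u' \<eta> \<longleftrightarrow> \<bar>cos \<eta> * (u' \<bullet> y)\<bar> \<le> sin \<eta> * (u \<bullet> y)"
  by (auto simp: wedge_def dual_cone_def inner_diff_left inner_add_left)

lemma closed_wedge [simp]: "closed (wedge u u' \<eta>)" by (simp add: wedge_def)

lemma closed_triangle [simp]: "closed (triangle C x u u' \<eta>)"
  unfolding triangle_def by (intro closed_Int closed_wedge closed_Collect_le continuous_intros)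

context
  fixes x u u' :: "real^3" and \<eta> C :: real
  assumes frame: "norm x = 1" "norm u = 1" "norm u' = 1" "x \<bullet> u = 0" "x \<bullet> u' = 0" "u \<bullet> u' = 0"
    and eta: "0 < \<eta>" "\<eta> < pi / 2" and C: "0 < C" "C < 1"
begin

lemma frame_dots: "x \<bullet> x = 1" "u \<bullet> u = 1" "u' \<bullet> u' = 1" "u \<bullet> x = 0" "u' \<bullet> x = 0" "u' \<bullet> u = 0"
  using frame by (auto simp: norm_eq_1 inner_commute)

lemma trig_pos: "0 < sin \<eta>" "0 < cos \<eta>" "0 < sqrt (1 - C\<^sup>2)"
  using eta C by (auto intro!: sin_gt_zero cos_gt_zero simp: power_less_one_iff abs_square_less_1)

lemma wedge_normals:
  "norm (sin \<eta> *\<^sub>R u - cos \<eta> *\<^sub>R u') = 1" "norm (sin \<eta> *\<^sub>R u + cos \<eta> *\<^sub>R u') = 1"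
  "(sin \<eta> *\<^sub>R u - cos \<eta> *\<^sub>R u') \<bullet> (sin \<eta> *\<^sub>R u + cos \<eta> *\<^sub>R u') = cos (pi - 2 * \<eta>)"
  using sin_cos_squared_add[of \<eta>]
  by (simp_all add: norm_eq_1 inner_diff_left inner_diff_right inner_add_left inner_add_right
      frame_dots frame cos_double power2_eq_square)

lemma solid_angle_wedge: "solid_angle (wedge u u' \<eta>) = 4 * \<eta>"
  unfolding wedge_def solid_angle_lune[OF wedge_normals(1,2)] wedge_normals(3)
  using eta by (simp add: arccos_cos del: cos_pi_minus)

text \<open>Girard's formula for the three normals of the triangle; \<open>\<beta>\<close> is the complement of the base angle.\<close>

lemma solid_angle_isosceles_triangle: "solid_angle (triangle C x u u' \<eta>) = excess C \<eta>"
proof -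
  define S where "S = sqrt (1 - C\<^sup>2)"
  define D where "D = sqrt ((cos \<eta>)\<^sup>2 + C\<^sup>2 * (sin \<eta>)\<^sup>2)"
  define \<beta> where "\<beta> = arctan (C * tan \<eta>)"
  define m where "m = (1 / D) *\<^sub>R ((S * cos \<eta>) *\<^sub>R x - C *\<^sub>R u)"
  have S2: "S\<^sup>2 = 1 - C\<^sup>2" using C by (simp add: S_def power_le_one)
  have Dpos: "0 < D" unfolding D_def using trig_pos by (simp add: add_pos_nonneg)
  have D2: "D\<^sup>2 = (S * cos \<eta>)\<^sup>2 + C\<^sup>2"
  proof -
    have "(cos \<eta>)\<^sup>2 + C\<^sup>2 * (sin \<eta>)\<^sup>2 = (1 - C\<^sup>2) * (cos \<eta>)\<^sup>2 + C\<^sup>2"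
      by (simp add: sin_squared_eq algebra_simps)
    moreover have "0 \<le> (cos \<eta>)\<^sup>2 + C\<^sup>2 * (sin \<eta>)\<^sup>2" by simp
    ultimately show ?thesis by (simp add: D_def power_mult_distrib S2)
  qed
  have "((S * cos \<eta>) *\<^sub>R x - C *\<^sub>R u) \<bullet> ((S * cos \<eta>) *\<^sub>R x - C *\<^sub>R u) = D\<^sup>2"
    unfolding D2 by (simp add: inner_diff_left inner_diff_right frame_dots frame power2_eq_square)
  then have "norm ((S * cos \<eta>) *\<^sub>R x - C *\<^sub>R u) = D"
    using Dpos by (simp add: norm_eq_sqrt_inner)
  then have nm: "norm m = 1" using Dpos by (simp add: m_def)
  have tri: "triangle C x u u' \<eta> = dual_cone {sin \<eta> *\<^sub>R u - cos \<eta> *\<^sub>R u', sin \<eta> *\<^sub>R u + cos \<eta> *\<^sub>R u', m}"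
    using Dpos by (auto simp: triangle_def wedge_def dual_cone_def m_def inner_diff_left S_def zero_le_divide_iff)
  have tan_D: "C * tan \<eta> / sqrt (1 + (C * tan \<eta>)\<^sup>2) = C * sin \<eta> / D"
  proof -
    have "1 + (C * tan \<eta>)\<^sup>2 = ((cos \<eta>)\<^sup>2 + C\<^sup>2 * (sin \<eta>)\<^sup>2) / (cos \<eta>)\<^sup>2"
      using trig_pos by (simp add: tan_def field_simps)
    then have "sqrt (1 + (C * tan \<eta>)\<^sup>2) = D / cos \<eta>"
      using trig_pos by (simp add: D_def real_sqrt_divide)
    then show ?thesis using trig_pos by (simp add: tan_def)
  qed
  have sb: "sin \<beta> = C * sin \<eta> / D" unfolding \<beta>_def sin_arctan tan_D ..
  have \<beta>: "0 < \<beta>" "\<beta> < pi/2"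
    unfolding \<beta>_def using eta C arctan_ubound[of "C * tan \<eta>"] by (auto simp: tan_gt_zero)
  have i: "(sin \<eta> *\<^sub>R u + cos \<eta> *\<^sub>R u') \<bullet> m = - sin \<beta>" "(sin \<eta> *\<^sub>R u - cos \<eta> *\<^sub>R u') \<bullet> m = - sin \<beta>"
    unfolding sb m_def by (simp_all add: inner_diff_left inner_diff_right inner_add_left frame_dots frame)
  have "- sin \<beta> = cos (\<beta> + pi/2)" by (simp add: cos_add)
  then have ac: "arccos (- sin \<beta>) = \<beta> + pi/2" using \<beta> by (simp add: arccos_cos)
  show ?thesis
    unfolding tri solid_angle_triangle[OF wedge_normals(1,2) nm] i wedge_normals(3) ac
    using eta by (simp add: arccos_cos excess_def \<beta>_def del: cos_pi_minus)
qed

lemma triangle_subset_cap: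
  assumes y: "y \<in> triangle C x u u' \<eta>" shows "C * norm y \<le> x \<bullet> y"
proof -
  define S where "S = sqrt (1 - C\<^sup>2)"
  have S2: "S\<^sup>2 = 1 - C\<^sup>2" using C by (simp add: S_def power_le_one)
  have w: "\<bar>cos \<eta> * (u' \<bullet> y)\<bar> \<le> sin \<eta> * (u \<bullet> y)" and t: "C * (u \<bullet> y) \<le> S * cos \<eta> * (x \<bullet> y)"
    using y by (auto simp: triangle_def mem_wedge S_def)
  have "0 \<le> sin \<eta> * (u \<bullet> y)" using w by linarith
  then have u0: "0 \<le> u \<bullet> y" using trig_pos by (simp add: zero_le_mult_iff)
  have "0 \<le> S * cos \<eta> * (x \<bullet> y)" using t mult_nonneg_nonneg[of C "u \<bullet> y"] u0 C by linarith
  moreover have "0 < S * cos \<eta>" using trig_pos by (simp add: S_def)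
  ultimately have x0: "0 \<le> x \<bullet> y" by (simp add: zero_le_mult_iff)
  have "(cos \<eta> * (u' \<bullet> y))\<^sup>2 \<le> (sin \<eta> * (u \<bullet> y))\<^sup>2"
    using power_mono[OF w, of 2] by simp
  then have 1: "(cos \<eta>)\<^sup>2 * ((u \<bullet> y)\<^sup>2 + (u' \<bullet> y)\<^sup>2) \<le> (u \<bullet> y)\<^sup>2"
    by (simp add: power_mult_distrib sin_squared_eq algebra_simps)
  have "(C * (u \<bullet> y))\<^sup>2 \<le> (S * cos \<eta> * (x \<bullet> y))\<^sup>2"
    using t u0 C by (intro power_mono) auto
  then have "C\<^sup>2 * ((cos \<eta>)\<^sup>2 * ((u \<bullet> y)\<^sup>2 + (u' \<bullet> y)\<^sup>2)) \<le> (S * cos \<eta> * (x \<bullet> y))\<^sup>2"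
    using mult_left_mono[OF 1, of "C\<^sup>2"] by (simp add: power_mult_distrib)
  then have "(cos \<eta>)\<^sup>2 * (C\<^sup>2 * ((u \<bullet> y)\<^sup>2 + (u' \<bullet> y)\<^sup>2)) \<le> (cos \<eta>)\<^sup>2 * (S\<^sup>2 * (x \<bullet> y)\<^sup>2)"
    by (simp add: power_mult_distrib algebra_simps)
  then have "C\<^sup>2 * ((u \<bullet> y)\<^sup>2 + (u' \<bullet> y)\<^sup>2) \<le> S\<^sup>2 * (x \<bullet> y)\<^sup>2" using trig_pos by simp
  then have "(C * norm y)\<^sup>2 \<le> (x \<bullet> y)\<^sup>2"
    by (simp add: power_mult_distrib power2_norm_eq_inner frame_expansion(2)[OF frame, of y] S2 algebra_simps)
  then show ?thesis using x0 by (rule power2_le_imp_le)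
qed

text \<open>The triangle lies in the part of the cap inside the wedge of angle \<open>2\<eta>\<close>, and by rotational
invariance this part is the fraction \<open>2\<eta> / (2\<pi>)\<close> of the cap.\<close>

lemma excess_le_cap:
  "excess C \<eta> \<le> \<eta> / pi * solid_angle {y. C * norm y \<le> x \<bullet> y}"
proof -
  let ?K = "{y. C * norm y \<le> x \<bullet> y}"
  \<comment> \<open>The second normal of the wedge arises from the first by rotation through \<open>pi - 2 * \<eta>\<close>.\<close>
  define n1 where "n1 = sin \<eta> *\<^sub>R u - cos \<eta> *\<^sub>R u'"
  define e2 where "e2 = cos \<eta> *\<^sub>R u + sin \<eta> *\<^sub>R u'"
  have e: "norm e2 = 1" "n1 \<bullet> e2 = 0" "x \<bullet> n1 = 0" "x \<bullet> e2 = 0"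
    using sin_cos_squared_add[of \<eta>]
    by (simp_all add: e2_def n1_def norm_eq_1 inner_diff_left inner_diff_right inner_add_left inner_add_right
      frame_dots frame power2_eq_square)
  have n2: "cos (pi - 2*\<eta>) *\<^sub>R n1 + sin (pi - 2*\<eta>) *\<^sub>R e2 = sin \<eta> *\<^sub>R u + cos \<eta> *\<^sub>R u'"
  proof -
    have "- cos (2*\<eta>) * sin \<eta> + sin (2*\<eta>) * cos \<eta> = sin \<eta> * ((sin \<eta>)\<^sup>2 + (cos \<eta>)\<^sup>2)"
      "cos (2*\<eta>) * cos \<eta> + sin (2*\<eta>) * sin \<eta> = cos \<eta> * ((sin \<eta>)\<^sup>2 + (cos \<eta>)\<^sup>2)"
      unfolding cos_double sin_double by algebra+
    moreover have "cos (pi - 2*\<eta>) *\<^sub>R n1 + sin (pi - 2*\<eta>) *\<^sub>R e2 =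
       (- cos (2*\<eta>) * sin \<eta> + sin (2*\<eta>) * cos \<eta>) *\<^sub>R u + (cos (2*\<eta>) * cos \<eta> + sin (2*\<eta>) * sin \<eta>) *\<^sub>R u'"
      by (simp add: n1_def e2_def algebra_simps)
    ultimately show ?thesis by simp
  qed
  have cl: "closed ?K" by (intro closed_Collect_le continuous_intros)
  have "measure lebesgue (?K \<inter> cball 0 1 \<inter> {y. 0 \<le> n1 \<bullet> y \<and> 0 \<le> (cos (pi - 2*\<eta>) *\<^sub>R n1 + sin (pi - 2*\<eta>) *\<^sub>R e2) \<bullet> y})
    = (1/2 - (pi - 2*\<eta>) / (2*pi)) * measure lebesgue (?K \<inter> cball 0 1)"
    by (rule measure_invariant_wedge[where x = x])
      (use e eta wedge_normals(1) cl in \<open>auto simp: lmeasurable_Int_cball inner_commute n1_def\<close>)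
  also have "{y. 0 \<le> n1 \<bullet> y \<and> 0 \<le> (cos (pi - 2*\<eta>) *\<^sub>R n1 + sin (pi - 2*\<eta>) *\<^sub>R e2) \<bullet> y} = wedge u u' \<eta>"
    unfolding n2 by (simp add: wedge_def dual_cone_def n1_def)
  finally have "solid_angle (?K \<inter> wedge u u' \<eta>) = \<eta> / pi * solid_angle ?K"
    by (simp add: solid_angle_def Int_ac diff_divide_distrib)
  moreover have "solid_angle (triangle C x u u' \<eta>) \<le> solid_angle (?K \<inter> wedge u u' \<eta>)"
    by (rule solid_angle_mono) (use triangle_subset_cap cl in \<open>auto simp: triangle_def[of C x u u' \<eta>] closed_Int intro!: closed_triangle[unfolded triangle_def]\<close>)
  ultimately show ?thesis using solid_angle_isosceles_triangle by simp
qed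

end

text \<open>The preceding bound, divided by \<open>\<eta> / pi\<close>, in the limit \<open>\<eta> \<rightarrow> 0\<close>: the derivative of
\<open>\<eta> \<mapsto> arctan (C * tan \<eta>)\<close> at \<open>0\<close> is \<open>C\<close>.\<close>

lemma Sarea_cap_ge:
  assumes x: "norm x = 1" and r: "0 < \<rho>" "\<rho> < pi/2"
  shows "2 * pi * (1 - cos \<rho>) \<le> Sarea (spherical_cap x \<rho>)"
proof -
  define C where "C = cos \<rho>"
  have C: "0 < C" "C < 1" using r cos_gt_zero[of \<rho>] cos_monotone_0_pi[of 0 \<rho>] by (auto simp: C_def)
  obtain q where q: "q \<noteq> 0" "orthogonal x q" using orthogonal_to_vector_exists[of x] by auto
  define u where "u = (1 / norm q) *\<^sub>R q"
  define u' where "u' = cross3 x u"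
  have u: "norm u = 1" "x \<bullet> u = 0" using q by (auto simp: u_def orthogonal_def)
  have "(norm u')\<^sup>2 = 1" using norm_cross[of x u] u x by (simp add: u'_def)
  then have u': "norm u' = 1" "x \<bullet> u' = 0" "u \<bullet> u' = 0"
    by (auto simp: u'_def dot_cross_self power2_eq_1_iff) (smt (verit) norm_ge_zero)
  have cone: "solid_angle {y. C * norm y \<le> x \<bullet> y} = Sarea (spherical_cap x \<rho>)"
  proof -
    have "spherical_cap x \<rho> = {y. C * norm y \<le> x \<bullet> y} \<inter> S2"
      by (auto simp: spherical_cap_def C_def inner_commute)
    moreover have "c *\<^sub>R y \<in> {y. C * norm y \<le> x \<bullet> y}" if "y \<in> {y. C * norm y \<le> x \<bullet> y}" "0 \<le> c" for y c
      using mult_left_mono[of "C * norm y" "x \<bullet> y" c] that by (simp add: mult_ac)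
    ultimately show ?thesis by (subst Sarea_cone[symmetric]) auto
  qed
  have "2 * pi * (1 - arctan (C * tan \<eta>) / \<eta>) \<le> Sarea (spherical_cap x \<rho>)" if "0 < \<eta>" "\<eta> < pi/2" for \<eta>
  proof -
    have "2 * (\<eta> - arctan (C * tan \<eta>)) \<le> \<eta> / pi * Sarea (spherical_cap x \<rho>)"
      using excess_le_cap[OF x u(1) u'(1) u(2) u'(2,3) that C] unfolding cone excess_def .
    from mult_right_mono[OF this, of "pi / \<eta>"] show ?thesis using that by (simp add: field_simps)
  qed
  then have ev: "eventually (\<lambda>\<eta>. 2 * pi * (1 - arctan (C * tan \<eta>) / \<eta>) \<le> Sarea (spherical_cap x \<rho>)) (at_right 0)"
    using eventually_at_right_real[of 0 "pi/2"] by (auto elim!: eventually_mono)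
  have "((\<lambda>\<eta>. 2 * pi * (1 - arctan (C * tan \<eta>) / \<eta>)) \<longlongrightarrow> 2 * pi * (1 - C)) (at_right 0)"
  proof -
    have "((\<lambda>\<eta>. arctan (C * tan \<eta>)) has_real_derivative C) (at 0)"
      by (rule derivative_eq_intros refl | simp)+
    then have "((\<lambda>\<eta>. arctan (C * tan \<eta>) / \<eta>) \<longlongrightarrow> C) (at 0)"
      by (simp add: DERIV_def)
    then have "((\<lambda>\<eta>. arctan (C * tan \<eta>) / \<eta>) \<longlongrightarrow> C) (at_right 0)"
      by (rule tendsto_mono[rotated]) (simp add: at_le)
    then show ?thesis by (intro tendsto_intros)
  qed
  then show ?thesis unfolding C_def[symmetric]
    by (rule tendsto_upperbound[OF _ ev]) simp
qed

section \<open>The area of a cell in terms of its number of sides\<close>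

text \<open>The graph of \<open>excess C\<close> lies below its tangent at \<open>pi/4\<close>. The derivative is
\<open>2 - 2 * C / (cos\<^sup>2 u + C\<^sup>2 * sin\<^sup>2 u)\<close>, and since the denominator decreases on \<open>[0, pi/2]\<close>, the difference
between tangent and function falls up to \<open>pi/4\<close> and rises afterwards.\<close>

lemma excess_tangent:
  assumes C: "0 < C" "C < 1" and u: "0 \<le> u" "u < pi/2"
  shows "excess C u \<le> excess C (pi/4) + 2 * (1 - 2 * C / (1 + C\<^sup>2)) * (u - pi/4)"
proof -
  define b where "b = 1 - 2 * C / (1 + C\<^sup>2)"
  define p where "p u = 2 * b * (u - pi/4) - excess C u" for u
  define p' where "p' u = 2 * (C / ((cos u)\<^sup>2 + C\<^sup>2 * (sin u)\<^sup>2) - 2 * C / (1 + C\<^sup>2))" for u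
  have den: "0 < (cos t)\<^sup>2 + C\<^sup>2 * (sin t)\<^sup>2" if "0 \<le> t" "t < pi/2" for t
    using that cos_gt_zero_pi[of t] by (intro add_pos_nonneg) auto
  have der: "(p has_real_derivative p' t) (at t)" if t: "0 \<le> t" "t < pi/2" for t
  proof -
    have c: "cos t > 0" using t by (intro cos_gt_zero_pi) auto
    have "1 + (C * tan t)\<^sup>2 = ((cos t)\<^sup>2 + C\<^sup>2 * (sin t)\<^sup>2) / (cos t)\<^sup>2"
      using c by (simp add: tan_def field_simps)
    then have eq: "C * (1 / (cos t)\<^sup>2) / (1 + (C * tan t)\<^sup>2) = C / ((cos t)\<^sup>2 + C\<^sup>2 * (sin t)\<^sup>2)"
      using c den[OF t] by (simp add: field_simps)
    have "(p has_real_derivative 2 * b - 2 * (1 - C * (1 / (cos t)\<^sup>2) / (1 + (C * tan t)\<^sup>2))) (at t)"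
      unfolding p_def excess_def
      by (rule derivative_eq_intros refl | use c in \<open>simp add: field_simps\<close>)+
    then show ?thesis unfolding eq b_def p'_def by (simp add: algebra_simps)
  qed
  have sq: "(cos t)\<^sup>2 + C\<^sup>2 * (sin t)\<^sup>2 = (1 + C\<^sup>2) / 2 + (1 - C\<^sup>2) * cos (2*t) / 2" for t
    by (simp add: cos_double_cos sin_squared_eq) (simp add: field_simps)
  have C2: "C\<^sup>2 < 1" using C by (simp add: power_less_one_iff)
  have "p (pi/4) \<le> p u"
  proof (cases "u \<le> pi/4")
    case True
    show ?thesis
    proof (rule DERIV_nonpos_imp_nonincreasing[OF True])
      fix t assume t: "u \<le> t" "t \<le> pi/4"
      have "0 \<le> cos (2*t)" using t u by (intro cos_ge_zero) auto
      then have "(1 + C\<^sup>2)/2 \<le> (cos t)\<^sup>2 + C\<^sup>2 * (sin t)\<^sup>2" unfolding sq using C2 by simp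
      then have "C / ((cos t)\<^sup>2 + C\<^sup>2 * (sin t)\<^sup>2) \<le> C / ((1 + C\<^sup>2)/2)"
        using C den[of t] t u by (intro divide_left_mono mult_pos_pos) (auto intro: add_pos_nonneg)
      then show "\<exists>y. (p has_real_derivative y) (at t) \<and> y \<le> 0"
        using der[of t] t u by (intro exI[of _ "p' t"]) (auto simp: p'_def)
    qed
  next
    case False
    show ?thesis
    proof (rule DERIV_nonneg_imp_nondecreasing[of "pi/4" u p])
      show "pi/4 \<le> u" using False by simp
      fix t assume t: "pi/4 \<le> t" "t \<le> u"
      have "0 \<le> cos (pi - 2*t)" using t u by (intro cos_ge_zero) auto
      then have "cos (2*t) \<le> 0" by simp
      then have "(cos t)\<^sup>2 + C\<^sup>2 * (sin t)\<^sup>2 \<le> (1 + C\<^sup>2)/2"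
        unfolding sq using mult_nonneg_nonpos[of "1 - C\<^sup>2" "cos (2*t)"] C2 by linarith
      then have "C / ((1 + C\<^sup>2)/2) \<le> C / ((cos t)\<^sup>2 + C\<^sup>2 * (sin t)\<^sup>2)"
        using C den[of t] t u by (intro divide_left_mono mult_pos_pos) (auto intro: add_pos_nonneg)
      then show "\<exists>y. (p has_real_derivative y) (at t) \<and> 0 \<le> y"
        using der[of t] t u by (intro exI[of _ "p' t"]) (auto simp: p'_def)
    qed
  qed
  then show ?thesis by (simp add: p_def b_def)
qed

text \<open>The tangent of \<open>excess C\<close> at \<open>pi/4\<close>, written as \<open>side_weight C + angle_weight C * \<theta>\<close> in terms of the
apex angle \<open>\<theta> = 2\<eta>\<close>.\<close>

definition angle_weight :: "real \<Rightarrow> real" where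
  "angle_weight C = 1 - 2 * C / (1 + C\<^sup>2)"

definition side_weight :: "real \<Rightarrow> real" where
  "side_weight C = excess C (pi/4) - angle_weight C * (pi/2)"

lemma angle_weight_nonneg: "0 \<le> angle_weight C"
proof -
  have "2 * C \<le> 1 + C\<^sup>2" using sum_squares_bound[of 1 C] by simp
  moreover have "0 < 1 + C\<^sup>2" by (simp add: add_pos_nonneg)
  ultimately show ?thesis by (simp add: angle_weight_def)
qed

lemma excess_le_weights:
  assumes "0 < C" "C < 1" "0 \<le> \<eta>" "\<eta> < pi / 2"
  shows "excess C \<eta> \<le> side_weight C + 2 * angle_weight C * \<eta>"
  using excess_tangent[OF assms] unfolding side_weight_def angle_weight_def[symmetric] by (simp add: algebra_simps)

lemma side_weight_nonneg:
  assumes "0 < C" "C < 1" shows "0 \<le> side_weight C"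
  using excess_le_weights[OF assms, of 0] by (simp add: excess_def)

text \<open>Here \<open>K\<close> lies in the triangle with apex \<open>x\<close> whose base lies in the plane orthogonal to \<open>m\<close> and has ends \<open>v\<close>
and \<open>w\<close>, and \<open>dual_cone N\<close> contains the wedge spanned by it. The normalization \<open>x \<bullet> v = 1\<close> places \<open>v\<close>
and \<open>w\<close> in the plane tangent to the sphere at \<open>x\<close>. With \<open>g\<close>, \<open>h\<close> the unit directions from \<open>x\<close> to
\<open>v\<close>, \<open>w\<close> there, the bisector \<open>u\<close> and the orthogonal direction \<open>u'\<close> are the normalized sum and
difference of \<open>h\<close> and \<open>g\<close>. Lengthening both legs to \<open>arccos C\<close> turns \<open>K\<close> into a larger isosceles
triangle with the same angle at \<open>x\<close>.\<close>

lemma sector_bound: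
  fixes x m v w :: "real^3"
  assumes C: "0 < C" "C < 1" and x: "norm x = 1" and mx: "m \<bullet> x = 1"
    and v: "m \<bullet> v = 0" "x \<bullet> v = 1" "C * norm v \<le> 1"
    and w: "m \<bullet> w = 0" "x \<bullet> w = 1" "C * norm w \<le> 1" and vw: "v \<noteq> w"
    and W: "x \<in> dual_cone N" "- x \<in> dual_cone N" "v \<in> dual_cone N" "w \<in> dual_cone N"
    and K: "closed K" "\<And>y. y \<in> K \<Longrightarrow> \<exists>a b c. 0 \<le> a \<and> 0 \<le> b \<and> 0 \<le> c \<and> y = a *\<^sub>R x + b *\<^sub>R v + c *\<^sub>R w"
  shows "solid_angle K \<le> side_weight C + angle_weight C / 2 * solid_angle (dual_cone N)"
proof -
  define S where "S = sqrt (1 - C\<^sup>2)"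
  have C2: "C\<^sup>2 < 1" using C by (simp add: power_less_one_iff)
  have S: "0 < S" "S\<^sup>2 = 1 - C\<^sup>2" using C2 by (simp_all add: S_def)
  have xx: "x \<bullet> x = 1" using x by (simp add: norm_eq_1)
  define p q where "p = v - x" and "q = w - x"
  have mp: "m \<bullet> p = -1" "m \<bullet> q = -1" by (simp_all add: p_def q_def inner_diff_right v w mx)
  have xp: "x \<bullet> p = 0" "x \<bullet> q = 0" by (simp_all add: p_def q_def inner_diff_right v w xx)
  have pq0: "0 < norm p" "0 < norm q" using mp by auto
  \<comment> \<open>The tangent of the distance from \<open>x\<close> is at most \<open>S / C\<close>, the tangent of the radius \<open>arccos C\<close>.\<close>
  have bnd: "C * norm (z - x) \<le> S" if z: "x \<bullet> z = 1" "C * norm z \<le> 1" for z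
  proof -
    have "(norm (z - x))\<^sup>2 = (norm z)\<^sup>2 - 1"
      by (simp add: power2_norm_eq_inner inner_diff_left inner_diff_right z xx inner_commute[of z x])
    moreover have "(C * norm z)\<^sup>2 \<le> 1" using z C by (simp add: power_le_one)
    ultimately have "C\<^sup>2 * (norm z)\<^sup>2 \<le> 1" "(C * norm (z - x))\<^sup>2 = C\<^sup>2 * (norm z)\<^sup>2 - C\<^sup>2"
      by (simp_all only: power_mult_distrib right_diff_distrib mult_1_right)
    then have "(C * norm (z - x))\<^sup>2 \<le> S\<^sup>2" using S(2) by linarith
    then show ?thesis by (rule power2_le_imp_le) (use S(1) in simp)
  qed
  define g h where "g = (1 / norm p) *\<^sub>R p" and "h = (1 / norm q) *\<^sub>R q"
  have ng: "norm g = 1" "norm h = 1" using pq0 by (simp_all add: g_def h_def)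
  have gg: "g \<bullet> g = 1" "h \<bullet> h = 1" using ng by (simp_all add: norm_eq_1)
  have mg: "m \<bullet> g = - 1 / norm p" "m \<bullet> h = - 1 / norm q" by (simp_all add: g_def h_def mp)
  have "g \<noteq> h"
  proof
    assume "g = h"
    then have "norm p = norm q" using mg pq0 by simp
    then have "p = q" using \<open>g = h\<close> pq0 by (simp add: g_def h_def)
    then show False using vw by (simp add: p_def q_def)
  qed
  have "g + h \<noteq> 0"
  proof
    assume "g + h = 0"
    then have "m \<bullet> g + m \<bullet> h = 0" by (simp flip: inner_add_right)
    moreover have "m \<bullet> g < 0" "m \<bullet> h < 0" using pq0 by (simp_all add: mg)
    ultimately show False by simp
  qed
  have n2: "(norm (g + h) / 2)\<^sup>2 + (norm (h - g) / 2)\<^sup>2 = 1"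
    by (simp add: power_divide power2_norm_eq_inner inner_add_left inner_add_right inner_diff_left
        inner_diff_right gg inner_commute) (simp add: field_simps)
  then obtain \<eta> where \<eta>: "0 \<le> \<eta>" "\<eta> \<le> pi/2" "norm (g + h) / 2 = cos \<eta>" "norm (h - g) / 2 = sin \<eta>"
    using sincos_total_pi_half[of "norm (g + h) / 2" "norm (h - g) / 2"] by auto
  have cs: "0 < cos \<eta>" "0 < sin \<eta>"
    using \<open>g \<noteq> h\<close> \<open>g + h \<noteq> 0\<close> by (simp_all flip: \<eta>(3,4))
  have "\<eta> \<noteq> 0" "\<eta> \<noteq> pi/2" using cs cos_pi_half by fastforce+
  with \<eta> have e: "0 < \<eta>" "\<eta> < pi/2" by auto
  define u u' where "u = (1 / (2 * cos \<eta>)) *\<^sub>R (g + h)" and "u' = (1 / (2 * sin \<eta>)) *\<^sub>R (h - g)"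
  have gh: "g = cos \<eta> *\<^sub>R u - sin \<eta> *\<^sub>R u'" "h = cos \<eta> *\<^sub>R u + sin \<eta> *\<^sub>R u'"
  proof -
    have "cos \<eta> *\<^sub>R u = (1/2) *\<^sub>R (g + h)" "sin \<eta> *\<^sub>R u' = (1/2) *\<^sub>R (h - g)"
      using cs by (simp_all add: u_def u'_def)
    moreover have "(1/2) *\<^sub>R (g + h) - (1/2) *\<^sub>R (h - g) = (1/2) *\<^sub>R (g + g)"
      "(1/2) *\<^sub>R (g + h) + (1/2) *\<^sub>R (h - g) = (1/2) *\<^sub>R (h + h)"
      by (simp_all add: scaleR_right_distrib scaleR_right_diff_distrib)
    ultimately show "g = cos \<eta> *\<^sub>R u - sin \<eta> *\<^sub>R u'" "h = cos \<eta> *\<^sub>R u + sin \<eta> *\<^sub>R u'"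
      by (simp_all only: scaleR_half_double)
  qed
  have frame: "norm x = 1" "norm u = 1" "norm u' = 1" "x \<bullet> u = 0" "x \<bullet> u' = 0" "u \<bullet> u' = 0"
  proof -
    show "norm u = 1" using \<eta>(3) cs by (simp add: u_def)
    show "norm u' = 1" using \<eta>(4) cs by (simp add: u'_def)
    have "x \<bullet> g = 0" "x \<bullet> h = 0" by (simp_all add: g_def h_def xp)
    then show "x \<bullet> u = 0" "x \<bullet> u' = 0" by (simp_all add: u_def u'_def inner_add_right inner_diff_right)
    have "(g + h) \<bullet> (h - g) = 0"
      by (simp add: inner_add_left inner_diff_right gg inner_commute[of h g])
    then show "u \<bullet> u' = 0" by (simp add: u_def u'_def)
  qed (fact x)
  note fd = frame_dots[OF frame e C] frame(4-6)
  have uv: "u \<bullet> v = norm p * cos \<eta>" "u' \<bullet> v = - norm p * sin \<eta>"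
       "u \<bullet> w = norm q * cos \<eta>" "u' \<bullet> w = norm q * sin \<eta>"
  proof -
    have "v = x + norm p *\<^sub>R g" "w = x + norm q *\<^sub>R h" using pq0 by (simp_all add: g_def h_def p_def q_def)
    then have v': "v = x + norm p *\<^sub>R (cos \<eta> *\<^sub>R u - sin \<eta> *\<^sub>R u')"
      and w': "w = x + norm q *\<^sub>R (cos \<eta> *\<^sub>R u + sin \<eta> *\<^sub>R u')" unfolding gh by auto
    show "u \<bullet> v = norm p * cos \<eta>" "u' \<bullet> v = - norm p * sin \<eta>"
      by (subst v', simp add: inner_add_right inner_diff_right fd)+
    show "u \<bullet> w = norm q * cos \<eta>" "u' \<bullet> w = norm q * sin \<eta>"
      by (subst w', simp add: inner_add_right inner_diff_right fd)+
  qed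
  have KT: "K \<subseteq> triangle C x u u' \<eta>"
  proof
    fix y assume "y \<in> K"
    then obtain a b c where abc: "0 \<le> a" "0 \<le> b" "0 \<le> c" and y: "y = a *\<^sub>R x + b *\<^sub>R v + c *\<^sub>R w"
      using K by blast
    have yd: "x \<bullet> y = a + b + c" "u \<bullet> y = (b * norm p + c * norm q) * cos \<eta>"
      "u' \<bullet> y = (c * norm q - b * norm p) * sin \<eta>"
      by (simp_all add: y inner_add_right fd v w uv algebra_simps)
    have "\<bar>c * norm q - b * norm p\<bar> \<le> b * norm p + c * norm q"
      using abc by (simp add: abs_le_iff)
    then have "\<bar>c * norm q - b * norm p\<bar> * (sin \<eta> * cos \<eta>) \<le> (b * norm p + c * norm q) * (sin \<eta> * cos \<eta>)"
      using cs by (intro mult_right_mono) auto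
    then have "\<bar>cos \<eta> * (u' \<bullet> y)\<bar> \<le> sin \<eta> * (u \<bullet> y)"
      unfolding yd using cs by (simp add: abs_mult mult_ac)
    moreover have "C * (u \<bullet> y) \<le> S * cos \<eta> * (x \<bullet> y)"
    proof -
      have "b * (C * norm p) \<le> b * S" "c * (C * norm q) \<le> c * S" "0 \<le> a * S"
        using bnd[of v] bnd[of w] v w abc S by (auto simp: p_def q_def intro!: mult_left_mono)
      then have "C * (b * norm p + c * norm q) \<le> S * (a + b + c)" by (simp add: algebra_simps)
      then have "C * (b * norm p + c * norm q) * cos \<eta> \<le> S * (a + b + c) * cos \<eta>"
        using cs by (intro mult_right_mono) auto
      then show ?thesis unfolding yd by (simp add: mult_ac)
    qed
    ultimately show "y \<in> triangle C x u u' \<eta>" by (simp add: triangle_def mem_wedge S_def)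
  qed
  have WW: "wedge u u' \<eta> \<subseteq> dual_cone N"
  proof
    fix y assume y: "y \<in> wedge u u' \<eta>"
    define b where "b = ((u \<bullet> y) * sin \<eta> - (u' \<bullet> y) * cos \<eta>) / (2 * sin \<eta> * cos \<eta>)"
    define c where "c = ((u \<bullet> y) * sin \<eta> + (u' \<bullet> y) * cos \<eta>) / (2 * sin \<eta> * cos \<eta>)"
    have bc: "0 \<le> b" "0 \<le> c" using y cs by (auto simp: mem_wedge b_def c_def abs_le_iff mult_ac)
    have "u \<bullet> y = (b + c) * cos \<eta>" "u' \<bullet> y = (c - b) * sin \<eta>"
      using cs by (simp_all add: b_def c_def field_simps)
    then have "y = (x \<bullet> y) *\<^sub>R x + ((b + c) * cos \<eta>) *\<^sub>R u + ((c - b) * sin \<eta>) *\<^sub>R u'"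
      using frame_expansion(1)[OF frame, of y] by simp
    also have "\<dots> = (x \<bullet> y) *\<^sub>R x + b *\<^sub>R g + c *\<^sub>R h"
      unfolding gh by (simp add: algebra_simps)
    also have "\<dots> = (x \<bullet> y - b / norm p - c / norm q) *\<^sub>R x + (b / norm p) *\<^sub>R v + (c / norm q) *\<^sub>R w"
      by (simp add: g_def h_def p_def q_def algebra_simps)
    finally have yy: "y = (x \<bullet> y - b / norm p - c / norm q) *\<^sub>R x + (b / norm p) *\<^sub>R v + (c / norm q) *\<^sub>R w" .
    have "t *\<^sub>R x \<in> dual_cone N" for t
      using dual_cone_scaleR[OF W(1), of t] dual_cone_scaleR[OF W(2), of "-t"] by (cases "0 \<le> t") auto
    moreover have "(b / norm p) *\<^sub>R v \<in> dual_cone N" "(c / norm q) *\<^sub>R w \<in> dual_cone N"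
      using bc by (auto intro!: dual_cone_scaleR W)
    ultimately show "y \<in> dual_cone N" by (subst yy) (intro dual_cone_add)
  qed
  have "solid_angle K \<le> excess C \<eta>"
    using solid_angle_mono[OF K(1) closed_triangle KT] solid_angle_isosceles_triangle[OF frame e C] by simp
  also have "\<dots> \<le> side_weight C + angle_weight C / 2 * (4 * \<eta>)"
    using excess_le_weights[OF C, of \<eta>] e by (simp add: mult_ac)
  also have "4 * \<eta> \<le> solid_angle (dual_cone N)"
    using solid_angle_mono[OF closed_wedge closed_dual_cone WW] solid_angle_wedge[OF frame e C] by simp
  finally show ?thesis using angle_weight_nonneg[of C] by (auto intro: mult_left_mono)
qed

text \<open>Two linearly independent vectors and their cross product span the space.\<close>

lemma cross3_dot_zero_imp_0:
  assumes "x \<bullet> g = 0" "m \<bullet> g = 0" "cross3 x m \<bullet> g = 0" "cross3 x m \<noteq> 0"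
  shows "g = 0"
proof -
  have "cross3 g (cross3 x m) = 0"
    using assms(1,2) by (simp add: Lagrange inner_commute)
  then have "cross3 (cross3 x m) g = 0" by (metis cross_skew neg_equal_0_iff_equal)
  then show ?thesis using norm_and_cross_eq_0[of "cross3 x m" g] assms(3,4) by simp
qed

text \<open>A closed convex cone in a plane, all of whose directions lie in the cap of cosine \<open>C\<close> around \<open>x\<close>, is
spanned by two rays, unless it is zero. The section of the cone by \<open>x \<bullet> f = 1\<close> is a compact segment, and its ends minimize and
maximize the linear functional given by \<open>cross3 x m\<close>, which together with \<open>x\<close> serves as a coordinate
on the plane.\<close>

lemma pointed_plane_cone_generators:
  fixes F :: "(real^3) set"
  assumes F: "closed F" "convex F" "\<And>f c. f \<in> F \<Longrightarrow> 0 \<le> c \<Longrightarrow> c *\<^sub>R f \<in> F"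
    and C: "0 < C" and cap: "\<And>f. f \<in> F \<Longrightarrow> C * norm f \<le> x \<bullet> f"
    and plane: "\<And>f. f \<in> F \<Longrightarrow> m \<bullet> f = 0" and xm: "cross3 x m \<noteq> 0"
  shows "F \<subseteq> {0} \<or> (\<exists>v\<in>F. \<exists>w\<in>F. x \<bullet> v = 1 \<and> x \<bullet> w = 1 \<and>
     (\<forall>f\<in>F. \<exists>a b. 0 \<le> a \<and> 0 \<le> b \<and> f = a *\<^sub>R v + b *\<^sub>R w))"
proof (cases "F \<subseteq> {0}")
  case False
  define e where "e = cross3 x m"
  define F1 where "F1 = F \<inter> {f. x \<bullet> f = 1}"
  have F1I: "(1 / (x \<bullet> f)) *\<^sub>R f \<in> F1" "0 < x \<bullet> f" if "f \<in> F" "f \<noteq> 0" for f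
  proof -
    have "0 < C * norm f" using that C by simp
    then show "0 < x \<bullet> f" using cap[OF that(1)] by linarith
    then show "(1 / (x \<bullet> f)) *\<^sub>R f \<in> F1" using F(3)[OF that(1), of "1 / (x \<bullet> f)"] by (simp add: F1_def)
  qed
  have "F1 \<noteq> {}" using False F1I by blast
  moreover have "compact F1"
  proof -
    have "norm f \<le> 1 / C" if "f \<in> F1" for f
      using cap[of f] that C by (simp add: F1_def field_simps)
    then have "bounded F1" by (rule boundedI)
    moreover have "closed F1" unfolding F1_def
      by (intro closed_Int F closed_Collect_eq continuous_intros)
    ultimately show ?thesis by (simp add: compact_eq_bounded_closed)
  qed
  moreover have cont: "continuous_on F1 (\<lambda>f. e \<bullet> f)" by (intro continuous_intros)
  ultimately obtain v w where v: "v \<in> F1" "\<And>f. f \<in> F1 \<Longrightarrow> e \<bullet> v \<le> e \<bullet> f"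
    and w: "w \<in> F1" "\<And>f. f \<in> F1 \<Longrightarrow> e \<bullet> f \<le> e \<bullet> w"
    using continuous_attains_inf[of F1] continuous_attains_sup[of F1] by metis
  have comb: "\<exists>a b. 0 \<le> a \<and> 0 \<le> b \<and> f = a *\<^sub>R v + b *\<^sub>R w" if f: "f \<in> F1" for f
  proof -
    \<comment> \<open>If the two ends coincide the weight is arbitrary.\<close>
    define t where "t = (if e \<bullet> w = e \<bullet> v then 0 else (e \<bullet> f - e \<bullet> v) / (e \<bullet> w - e \<bullet> v))"
    have t: "0 \<le> t" "t \<le> 1" "e \<bullet> f = (1 - t) * (e \<bullet> v) + t * (e \<bullet> w)"
    proof -
      consider "e \<bullet> w = e \<bullet> v" | "e \<bullet> v < e \<bullet> w" using v(2)[OF f] w(2)[OF f] by linarith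
      then show "0 \<le> t" "t \<le> 1" using v(2)[OF f] w(2)[OF f] by (cases; simp add: t_def)+
      have "t * (e \<bullet> w - e \<bullet> v) = e \<bullet> f - e \<bullet> v"
        using v(2)[OF f] w(2)[OF f] by (simp add: t_def)
      then show "e \<bullet> f = (1 - t) * (e \<bullet> v) + t * (e \<bullet> w)" by (simp add: algebra_simps)
    qed
    define g where "g = f - (1 - t) *\<^sub>R v - t *\<^sub>R w"
    have "x \<bullet> g = 0" "m \<bullet> g = 0" "e \<bullet> g = 0"
      using f v(1) w(1) plane t(3) by (auto simp: g_def inner_diff_right F1_def)
    then have "g = 0" using cross3_dot_zero_imp_0 xm unfolding e_def by blast
    then show ?thesis using t by (intro exI[of _ "1 - t"] exI[of _ t]) (simp add: g_def algebra_simps)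
  qed
  have "\<exists>a b. 0 \<le> a \<and> 0 \<le> b \<and> f = a *\<^sub>R v + b *\<^sub>R w" if f: "f \<in> F" for f
  proof (cases "f = 0")
    case False
    obtain a b where ab: "0 \<le> a" "0 \<le> b" "(1 / (x \<bullet> f)) *\<^sub>R f = a *\<^sub>R v + b *\<^sub>R w"
      using comb[OF F1I(1)[OF f False]] by blast
    have "f = (x \<bullet> f) *\<^sub>R ((1 / (x \<bullet> f)) *\<^sub>R f)" using F1I(2)[OF f False] by simp
    also have "\<dots> = ((x \<bullet> f) * a) *\<^sub>R v + ((x \<bullet> f) * b) *\<^sub>R w" unfolding ab(3) by (simp add: algebra_simps)
    finally show ?thesis using ab F1I(2)[OF f False] by (intro exI[of _ "(x \<bullet> f) * a"] exI[of _ "(x \<bullet> f) * b"]) auto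
  qed (auto intro!: exI[of _ 0])
  then show ?thesis using v(1) w(1) by (intro disjI2 bexI[of _ v] bexI[of _ w]) (auto simp: F1_def)
qed auto

text \<open>The bound for one triangle of the decomposition of a cell: \<open>dual_cone N\<close> is a wedge with edge along
\<open>x\<close>, and adding the normal \<open>m\<close> of a side cuts it down to the triangle between \<open>x\<close> and that side. The
triangle may be degenerate, if the cone over the side is only a ray or the origin; its area is then zero.\<close>

lemma facet_bound:
  fixes x m :: "real^3"
  assumes C: "0 < C" "C < 1" and x: "norm x = 1" and mx: "m \<bullet> x = 1"
    and W: "x \<in> dual_cone N" "- x \<in> dual_cone N"
    and cap: "\<And>f. f \<in> dual_cone N \<Longrightarrow> m \<bullet> f = 0 \<Longrightarrow> C * norm f \<le> x \<bullet> f"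
  shows "solid_angle (dual_cone (insert m N)) \<le> side_weight C + angle_weight C / 2 * solid_angle (dual_cone N)"
proof -
  define K where "K = dual_cone (insert m N)"
  define F where "F = dual_cone N \<inter> {f. m \<bullet> f = 0}"
  have K: "\<exists>a f. 0 \<le> a \<and> f \<in> F \<and> y = a *\<^sub>R x + f" if "y \<in> K" for y
  proof -
    have "y + (m \<bullet> y) *\<^sub>R (- x) \<in> dual_cone N"
      using that by (intro dual_cone_add dual_cone_scaleR W) (auto simp: K_def dual_cone_def)
    then have "y - (m \<bullet> y) *\<^sub>R x \<in> F" by (simp add: F_def inner_diff_right mx)
    then show ?thesis using that
      by (intro exI[of _ "m \<bullet> y"] exI[of _ "y - (m \<bullet> y) *\<^sub>R x"]) (auto simp: K_def dual_cone_def)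
  qed
  have triv: ?thesis if "K \<subseteq> span {a, b}" for a b
    using solid_angle_planar[OF that] side_weight_nonneg[OF C] angle_weight_nonneg[of C] by (simp add: K_def)
  have capF: "C * norm f \<le> x \<bullet> f" if "f \<in> F" for f using that cap by (simp add: F_def)
  show ?thesis
  proof (cases "F \<subseteq> {0}")
    case True
    have "K \<subseteq> span {x, 0}"
    proof
      fix y assume "y \<in> K"
      then obtain a f where "f \<in> F" "y = a *\<^sub>R x + f" using K by blast
      with True have "y = a *\<^sub>R x" by auto
      then show "y \<in> span {x, 0}" by (auto intro: span_mul span_base)
    qed
    then show ?thesis by (rule triv)
  next
    case False
    have xm: "cross3 x m \<noteq> 0"
    proof
      assume "cross3 x m = 0"
      then have "cross3 x (m - x) = 0" by (simp add: Cross3.right_diff_distrib)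
      moreover have "x \<bullet> (m - x) = 0" using mx x by (simp add: inner_diff_right norm_eq_1 inner_commute)
      ultimately have "m = x" using norm_and_cross_eq_0[of x "m - x"] x by auto
      have "f = 0" if "f \<in> F" for f
        using capF[OF that] that C by (simp add: F_def \<open>m = x\<close> mult_le_0_iff)
      then show False using False by auto
    qed
    have "\<exists>v\<in>F. \<exists>w\<in>F. x \<bullet> v = 1 \<and> x \<bullet> w = 1 \<and> (\<forall>f\<in>F. \<exists>a b. 0 \<le> a \<and> 0 \<le> b \<and> f = a *\<^sub>R v + b *\<^sub>R w)"
    proof -
      have "closed F" "convex F"
        unfolding F_def by (intro closed_Int convex_Int closed_dual_cone convex_dual_cone closed_hyperplane convex_hyperplane)+
      moreover have "c *\<^sub>R f \<in> F" if "f \<in> F" "0 \<le> c" for f c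
        using that by (simp add: F_def dual_cone_scaleR)
      moreover have "m \<bullet> f = 0" if "f \<in> F" for f using that by (simp add: F_def)
      ultimately show ?thesis
        using pointed_plane_cone_generators[of F C x m, OF _ _ _ C(1) capF _ xm] False by blast
    qed
    then obtain v w where v: "v \<in> F" "x \<bullet> v = 1" and w: "w \<in> F" "x \<bullet> w = 1"
      and gen: "\<And>f. f \<in> F \<Longrightarrow> \<exists>a b. 0 \<le> a \<and> 0 \<le> b \<and> f = a *\<^sub>R v + b *\<^sub>R w" by blast
    have K3: "\<exists>a b c. 0 \<le> a \<and> 0 \<le> b \<and> 0 \<le> c \<and> y = a *\<^sub>R x + b *\<^sub>R v + c *\<^sub>R w" if y: "y \<in> K" for y
    proof -
      obtain a f where a: "0 \<le> a" "f \<in> F" "y = a *\<^sub>R x + f" using K[OF y] by blast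
      obtain b c where "0 \<le> b" "0 \<le> c" "f = b *\<^sub>R v + c *\<^sub>R w" using gen[OF a(2)] by blast
      then show ?thesis using a(1,3)
        by (intro exI[of _ a] exI[of _ b] exI[of _ c]) (simp add: add.assoc)
    qed
    show ?thesis
    proof (cases "v = w")
      case True
      have "K \<subseteq> span {x, v}"
      proof
        fix y assume "y \<in> K"
        then obtain a b c where "y = a *\<^sub>R x + b *\<^sub>R v + c *\<^sub>R v" using K3 True by metis
        then show "y \<in> span {x, v}" by (simp add: span_add span_mul span_base)
      qed
      then show ?thesis by (rule triv)
    next
      case False
      show ?thesis unfolding K_def[symmetric]
        by (rule sector_bound[OF C x mx _ v(2) _ _ w(2) _ False W])
          (use v w capF[OF v(1)] capF[OF w(1)] K3 in \<open>auto simp: F_def K_def\<close>)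
    qed
  qed
qed

text \<open>Scale the normals of the sides that do not contain \<open>x\<close> to have inner product \<open>1\<close> with \<open>x\<close>; this gives
the set \<open>M\<close>. The number \<open>m \<bullet> y\<close> for \<open>m \<in> M\<close> then says how far \<open>y\<close> can be moved in the direction \<open>- x\<close>
until it meets the side \<open>m\<close>. The triangle over \<open>m\<close> consists of the points of the cell that meet \<open>m\<close>
first, and the conditions \<open>m \<bullet> y \<le> m' \<bullet> y\<close> alone describe a wedge, as they are unchanged when a
multiple of \<open>x\<close> is added to \<open>y\<close>. Different wedges overlap only in planes, so their areas sum to at
most \<open>4 * pi\<close>.\<close>

lemma cell_bound:
  fixes x :: "real^3"
  assumes C: "0 < C" "C < 1" and x: "norm x = 1" "x \<in> dual_cone N" and fin: "finite N"
    and cap: "\<And>y. y \<in> dual_cone N \<Longrightarrow> C * norm y \<le> x \<bullet> y"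
  shows "solid_angle (dual_cone N) \<le> side_weight C * card N + 2 * pi * angle_weight C"
proof -
  define N0 where "N0 = {n \<in> N. n \<bullet> x = 0}"
  define M where "M = (\<lambda>n. (1 / (n \<bullet> x)) *\<^sub>R n) ` (N - N0)"
  define L where "L m = N0 \<union> (\<lambda>m'. m' - m) ` M" for m
  have nx: "0 \<le> n \<bullet> x" if "n \<in> N" for n using x that by (simp add: dual_cone_def)
  have finM: "finite M" and cardM: "card M \<le> card N"
    using fin card_image_le[of "N - N0" "\<lambda>n. (1 / (n \<bullet> x)) *\<^sub>R n"] card_mono[of N "N - N0"]
    by (simp_all add: M_def)
  have mx: "m \<bullet> x = 1" if "m \<in> M" for m
  proof -
    from that obtain n where "n \<in> N - N0" "m = (1 / (n \<bullet> x)) *\<^sub>R n" unfolding M_def by blast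
    then show ?thesis by (simp add: N0_def)
  qed
  have KN: "y \<in> dual_cone N \<longleftrightarrow> (\<forall>n\<in>N0. 0 \<le> n \<bullet> y) \<and> (\<forall>m\<in>M. 0 \<le> m \<bullet> y)" for y
  proof -
    have "0 \<le> n \<bullet> y \<longleftrightarrow> 0 \<le> ((1 / (n \<bullet> x)) *\<^sub>R n) \<bullet> y" if "n \<in> N - N0" for n
      using that nx[of n] by (auto simp: N0_def zero_le_divide_iff)
    then show ?thesis unfolding dual_cone_def M_def by (auto simp: N0_def)
  qed
  have L: "y \<in> dual_cone (L m) \<longleftrightarrow> (\<forall>n\<in>N0. 0 \<le> n \<bullet> y) \<and> (\<forall>m'\<in>M. m \<bullet> y \<le> m' \<bullet> y)" for y m
    unfolding L_def dual_cone_def by (simp add: ball_Un inner_diff_left)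
  have L': "y \<in> dual_cone (insert m (L m)) \<longleftrightarrow> y \<in> dual_cone (L m) \<and> 0 \<le> m \<bullet> y" for y m
    by (auto simp: dual_cone_def)
  have W: "x \<in> dual_cone (L m)" "- x \<in> dual_cone (L m)" if "m \<in> M" for m
    unfolding L using mx that by (auto simp: N0_def)
  have LK: "y \<in> dual_cone (insert m (L m)) \<longrightarrow> y \<in> dual_cone N" if "m \<in> M" for y m
    unfolding KN L' L using that by (meson order_trans)
  have M0: "M \<noteq> {}"
  proof
    assume "M = {}"
    then have "- x \<in> dual_cone N" using KN x by (auto simp: N0_def)
    then show False using cap[of "-x"] x C by (simp add: norm_eq_1)
  qed
  have cover: "dual_cone N \<subseteq> (\<Union>m\<in>M. dual_cone (insert m (L m))) \<union> {}"
  proof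
    fix y assume y: "y \<in> dual_cone N"
    obtain m where m: "m \<in> M" "\<And>m'. m' \<in> M \<Longrightarrow> m \<bullet> y \<le> m' \<bullet> y"
      using arg_min_if_finite(1)[OF finM M0, of "\<lambda>m. m \<bullet> y"] arg_min_least[OF finM M0, of _ "\<lambda>m. m \<bullet> y"] by blast
    then have "y \<in> dual_cone (insert m (L m))"
      using y unfolding KN L' L by blast
    then show "y \<in> (\<Union>m\<in>M. dual_cone (insert m (L m))) \<union> {}" using m by blast
  qed
  have "solid_angle (dual_cone N) \<le> (\<Sum>m\<in>M. solid_angle (dual_cone (insert m (L m))))"
    by (rule solid_angle_subadditive[OF finM _ _ cover]) auto
  also have "\<dots> \<le> (\<Sum>m\<in>M. side_weight C + angle_weight C / 2 * solid_angle (dual_cone (L m)))"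
  proof (rule sum_mono)
    fix m assume m: "m \<in> M"
    show "solid_angle (dual_cone (insert m (L m))) \<le> side_weight C + angle_weight C / 2 * solid_angle (dual_cone (L m))"
    proof (rule facet_bound[OF C x(1) mx[OF m] W[OF m]])
      fix f assume "f \<in> dual_cone (L m)" "m \<bullet> f = 0"
      then have "f \<in> dual_cone (insert m (L m))" by (simp add: L')
      then show "C * norm f \<le> x \<bullet> f" using LK[OF m] cap by blast
    qed
  qed
  also have "\<dots> = side_weight C * card M + angle_weight C / 2 * (\<Sum>m\<in>M. solid_angle (dual_cone (L m)))"
    by (simp add: sum.distrib sum_distrib_left)
  also have "\<dots> \<le> side_weight C * card N + angle_weight C / 2 * (4 * pi)"
  proof (intro add_mono mult_left_mono)
    show "(\<Sum>m\<in>M. solid_angle (dual_cone (L m))) \<le> 4 * pi"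
    proof (rule sum_solid_angle_le_sphere[OF finM])
      fix m m' assume mm: "m \<in> M" "m' \<in> M" "m \<noteq> m'"
      have "dual_cone (L m) \<inter> dual_cone (L m') \<subseteq> {y. (m - m') \<bullet> y = 0}"
        unfolding L Int_def using mm by (auto simp: L inner_diff_left intro: antisym)
      moreover have "negligible {y. (m - m') \<bullet> y = 0}" using mm by (intro negligible_hyperplane) auto
      ultimately show "negligible (dual_cone (L m) \<inter> dual_cone (L m'))" by (rule negligible_subset[rotated])
    qed simp
  qed (use cardM side_weight_nonneg[OF C] angle_weight_nonneg[of C] in auto)
  finally show ?thesis by simp
qed

section \<open>Counting the sides of the cells of an arrangement of planes\<close>

text \<open>The least number of half-spaces whose intersection is \<open>K\<close>. For a full-dimensional polyhedral cone
this is its number of sides.\<close>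

definition side_count :: "(real^3) set \<Rightarrow> nat" where
  "side_count K = (LEAST s. \<exists>N. finite N \<and> card N = s \<and> K = dual_cone N)"

lemma side_count_le: "finite N \<Longrightarrow> side_count (dual_cone N) \<le> card N"
  unfolding side_count_def by (rule Least_le) blast

lemma irredundant_representation:
  assumes "finite N0"
  obtains N where "finite N" "card N = side_count (dual_cone N0)" "dual_cone N0 = dual_cone N"
    "\<And>n. n \<in> N \<Longrightarrow> dual_cone (N - {n}) \<noteq> dual_cone N"
proof -
  have "\<exists>s N. finite N \<and> card N = s \<and> dual_cone N0 = dual_cone N" using assms by blast
  then have "\<exists>N. finite N \<and> card N = side_count (dual_cone N0) \<and> dual_cone N0 = dual_cone N"
    unfolding side_count_def by (rule LeastI_ex)
  then obtain N where N: "finite N" "card N = side_count (dual_cone N0)" "dual_cone N0 = dual_cone N" by blast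
  moreover have "dual_cone (N - {n}) \<noteq> dual_cone N" if "n \<in> N" for n
  proof
    assume "dual_cone (N - {n}) = dual_cone N"
    then have "card N \<le> card (N - {n})" using side_count_le[of "N - {n}"] N by simp
    moreover have "card (N - {n}) < card N" using that N(1) by (rule card_Diff1_less[rotated])
    ultimately show False by simp
  qed
  ultimately show ?thesis by (rule that)
qed

text \<open>Going from the interior point \<open>z\<close> straight to a point \<open>y\<close> outside the cone, one leaves it through the
first of the bounding planes that is reached.\<close>

lemma first_exit:
  assumes fin: "finite N" and z: "\<And>n. n \<in> N \<Longrightarrow> 0 < n \<bullet> z" and y: "y \<notin> dual_cone N"
  obtains t n where "n \<in> N" "n \<bullet> y < 0" "0 < t" "t < 1"
    "n \<bullet> ((1 - t) *\<^sub>R z + t *\<^sub>R y) = 0" "(1 - t) *\<^sub>R z + t *\<^sub>R y \<in> dual_cone N"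
proof -
  define B where "B = {n \<in> N. n \<bullet> y < 0}"
  define \<tau> where "\<tau> n = n \<bullet> z / (n \<bullet> z - n \<bullet> y)" for n
  have B: "finite B" "B \<noteq> {}" using fin y by (auto simp: B_def dual_cone_def not_le)
  obtain n where n: "n \<in> B" "\<And>m. m \<in> B \<Longrightarrow> \<tau> n \<le> \<tau> m"
    using arg_min_if_finite(1)[OF B, of \<tau>] arg_min_least[OF B, of _ \<tau>] by blast
  have nN: "n \<in> N" "n \<bullet> y < 0" "0 < n \<bullet> z" using n(1) z by (auto simp: B_def)
  have t: "0 < \<tau> n" "\<tau> n < 1" using nN by (auto simp: \<tau>_def)
  have eq: "m \<bullet> ((1 - t) *\<^sub>R z + t *\<^sub>R y) = m \<bullet> z - t * (m \<bullet> z - m \<bullet> y)" for m t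
    by (simp add: inner_add_right algebra_simps)
  have "0 \<le> m \<bullet> ((1 - \<tau> n) *\<^sub>R z + \<tau> n *\<^sub>R y)" if m: "m \<in> N" for m
  proof (cases "m \<bullet> y < 0")
    case True
    then have "\<tau> n \<le> \<tau> m" using m n by (simp add: B_def)
    moreover have "0 < m \<bullet> z - m \<bullet> y" using True z[OF m] by simp
    ultimately have "\<tau> n * (m \<bullet> z - m \<bullet> y) \<le> m \<bullet> z" by (simp add: \<tau>_def[of m] le_divide_eq)
    then show ?thesis by (simp only: eq)
  next
    case False
    then show ?thesis using t z[OF m] by (simp add: inner_add_right)
  qed
  moreover have "n \<bullet> ((1 - \<tau> n) *\<^sub>R z + \<tau> n *\<^sub>R y) = 0"
    unfolding eq using nN by (simp add: \<tau>_def)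
  ultimately show ?thesis using that[of n "\<tau> n"] nN t by (simp add: dual_cone_def)
qed

lemma relative_interior_point_of_side:
  assumes fin: "finite N" and z: "\<And>n. n \<in> N \<Longrightarrow> 0 < n \<bullet> z"
    and i: "i \<in> N" "dual_cone (N - {i}) \<noteq> dual_cone N"
  obtains p where "i \<bullet> p = 0" "\<And>m. m \<in> N \<Longrightarrow> m \<noteq> i \<Longrightarrow> 0 < m \<bullet> p"
proof -
  obtain y where y: "y \<in> dual_cone (N - {i})" "y \<notin> dual_cone N" using i by (auto simp: dual_cone_def)
  obtain t n where n: "n \<in> N" "n \<bullet> y < 0" "0 < t" "t < 1" "n \<bullet> ((1 - t) *\<^sub>R z + t *\<^sub>R y) = 0"
    using first_exit[OF fin z y(2)] by metis
  have "n = i"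
  proof (rule ccontr)
    assume "n \<noteq> i"
    then have "0 \<le> n \<bullet> y" using n(1) y(1) by (simp add: dual_cone_def)
    then show False using n(2) by simp
  qed
  moreover have "0 < m \<bullet> ((1 - t) *\<^sub>R z + t *\<^sub>R y)" if "m \<in> N" "m \<noteq> i" for m
    using that n y z[of m] by (auto simp: inner_add_right dual_cone_def intro!: add_pos_nonneg)
  ultimately show ?thesis using n that by blast
qed

text \<open>After cutting with \<open>h\<close>, only those sides are still needed that have a point strictly on the side of
\<open>h\<close> that is kept: a segment from an interior point to a point violating some other constraint leaves
the cone through a side, strictly within the half-space of \<open>h\<close>.\<close>

lemma cut_sides:
  assumes fin: "finite N" and z: "\<And>n. n \<in> N \<Longrightarrow> 0 < n \<bullet> z" and hz: "0 < h \<bullet> z"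
  shows "dual_cone (insert h N) = dual_cone (insert h {n \<in> N. \<exists>y\<in>dual_cone N. n \<bullet> y = 0 \<and> 0 < h \<bullet> y})"
    (is "_ = dual_cone (insert h ?A)")
proof
  show "dual_cone (insert h ?A) \<subseteq> dual_cone (insert h N)"
  proof
    fix y assume y: "y \<in> dual_cone (insert h ?A)"
    have "y \<in> dual_cone N"
    proof (rule ccontr)
      assume "y \<notin> dual_cone N"
      then obtain t n where n: "n \<in> N" "n \<bullet> y < 0" "0 < t" "t < 1"
        "n \<bullet> ((1 - t) *\<^sub>R z + t *\<^sub>R y) = 0" "(1 - t) *\<^sub>R z + t *\<^sub>R y \<in> dual_cone N"
        using first_exit[OF fin z] by metis
      have "0 < h \<bullet> ((1 - t) *\<^sub>R z + t *\<^sub>R y)"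
        using y n hz by (auto simp: inner_add_right dual_cone_def intro!: add_pos_nonneg)
      then have "n \<in> ?A" using n by blast
      then have "0 \<le> n \<bullet> y" using y by (simp add: dual_cone_def)
      then show False using n(2) by simp
    qed
    then show "y \<in> dual_cone (insert h N)" using y by (simp add: dual_cone_insert)
  qed
qed (auto simp: dual_cone_def)

lemma dependent_in_plane:
  fixes a b c h :: "real^3"
  assumes "h \<noteq> 0" "h \<bullet> a = 0" "h \<bullet> b = 0" "h \<bullet> c = 0" "a \<noteq> b" "a \<noteq> c" "b \<noteq> c"
  obtains \<alpha> \<beta> \<gamma> where "\<alpha> *\<^sub>R a + \<beta> *\<^sub>R b + \<gamma> *\<^sub>R c = 0" "\<alpha> \<noteq> 0 \<or> \<beta> \<noteq> 0 \<or> \<gamma> \<noteq> 0"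
proof -
  have "dependent {a, b, c}"
  proof (rule ccontr)
    assume "\<not> dependent {a, b, c}"
    then have "card {a, b, c} \<le> dim {y. h \<bullet> y = 0}"
      by (intro independent_card_le_dim) (use assms in auto)
    moreover have "dim {y. h \<bullet> y = 0} = 2" using dim_hyperplane[OF assms(1)] by simp
    moreover have "card {a, b, c} = 3" using assms by simp
    ultimately show False by simp
  qed
  then obtain u where u: "(\<exists>v\<in>{a,b,c}. u v \<noteq> 0)" "(\<Sum>v\<in>{a,b,c}. u v *\<^sub>R v) = 0"
    by (subst (asm) dependent_finite) auto
  show ?thesis
  proof (rule that)
    show "u a *\<^sub>R a + u b *\<^sub>R b + u c *\<^sub>R c = 0" using u(2) assms(5-7) by (simp add: add.assoc)
    show "u a \<noteq> 0 \<or> u b \<noteq> 0 \<or> u c \<noteq> 0" using u(1) by blast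
  qed
qed

text \<open>The vector \<open>r i\<close> is a point where the cutting plane crosses the relative interior of the side \<open>i\<close>.
Three such vectors in one plane are linearly dependent. Applying the normal of one side to the
relation shows that the coefficients of the other two have opposite signs, which is impossible for
all three pairs at once unless all coefficients vanish.\<close>

lemma at_most_two_crossed_sides:
  assumes h: "h \<noteq> 0" and fin: "finite I"
    and r: "\<And>i. i \<in> I \<Longrightarrow> h \<bullet> r i = 0" "\<And>i. i \<in> I \<Longrightarrow> i \<bullet> r i = 0"
      "\<And>i j. i \<in> I \<Longrightarrow> j \<in> I \<Longrightarrow> i \<noteq> j \<Longrightarrow> 0 < j \<bullet> r i"
  shows "card (I :: (real^3) set) \<le> 2"
proof (rule ccontr)
  assume "\<not> card I \<le> 2"
  then obtain T where T: "T \<subseteq> I" "card T = 3" using obtain_subset_with_card_n[of 3 I] by auto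
  then obtain i j k where "T = {i, j, k}" "i \<noteq> j" "j \<noteq> k" "i \<noteq> k" by (metis card_3_iff)
  with T(1) have ijk: "i \<in> I" "j \<in> I" "k \<in> I" "i \<noteq> j" "i \<noteq> k" "j \<noteq> k" by auto
  have pos: "0 < j \<bullet> r i" "0 < k \<bullet> r i" "0 < i \<bullet> r j" "0 < k \<bullet> r j" "0 < i \<bullet> r k" "0 < j \<bullet> r k"
    using r(3) ijk by auto
  have zero: "i \<bullet> r i = 0" "j \<bullet> r j = 0" "k \<bullet> r k = 0" using r(2) ijk by auto
  have ne: "r i \<noteq> r j" "r i \<noteq> r k" "r j \<noteq> r k" using pos zero by auto
  obtain \<alpha> \<beta> \<gamma> where d: "\<alpha> *\<^sub>R r i + \<beta> *\<^sub>R r j + \<gamma> *\<^sub>R r k = 0" "\<alpha> \<noteq> 0 \<or> \<beta> \<noteq> 0 \<or> \<gamma> \<noteq> 0"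
    using dependent_in_plane[OF h _ _ _ ne] r(1) ijk by metis
  have ei: "\<beta> * (i \<bullet> r j) + \<gamma> * (i \<bullet> r k) = 0"
    using arg_cong[OF d(1), of "inner i"] zero by (simp add: inner_add_right)
  have ej: "\<alpha> * (j \<bullet> r i) + \<gamma> * (j \<bullet> r k) = 0"
    using arg_cong[OF d(1), of "inner j"] zero by (simp add: inner_add_right)
  have ek: "\<alpha> * (k \<bullet> r i) + \<beta> * (k \<bullet> r j) = 0"
    using arg_cong[OF d(1), of "inner k"] zero by (simp add: inner_add_right)
  have opp: "sgn x = - sgn y" if "x * a + y * b = 0" "0 < a" "0 < b" for x y a b :: real
  proof -
    have "sgn (x * a) = sgn (- (y * b))" using that(1) by (simp add: add_eq_0_iff)
    then show ?thesis using that(2,3) by (simp add: sgn_mult sgn_minus)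
  qed
  have "sgn \<beta> = - sgn \<gamma>" "sgn \<alpha> = - sgn \<gamma>" "sgn \<alpha> = - sgn \<beta>"
    using opp[OF ei pos(3,5)] opp[OF ej pos(1,6)] opp[OF ek pos(2,4)] by blast+
  then have "sgn \<alpha> = 0" "sgn \<beta> = 0" "sgn \<gamma> = 0" by linarith+
  then show False using d(2) by (simp add: sgn_zero_iff)
qed

text \<open>Every old side survives in at most one part, except for the sides in \<open>A \<inter> B\<close>, which are crossed by the
cutting plane; there are at most two of these. Each part moreover gains \<open>h\<close> as a side. This
accounts for the four additional sides.\<close>

lemma side_count_cut:
  assumes fin: "finite N" and irr: "\<And>n. n \<in> N \<Longrightarrow> dual_cone (N - {n}) \<noteq> dual_cone N"
    and zp: "\<And>n. n \<in> N \<Longrightarrow> 0 < n \<bullet> zp" "0 < h \<bullet> zp"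
    and zm: "\<And>n. n \<in> N \<Longrightarrow> 0 < n \<bullet> zm" "h \<bullet> zm < 0"
  shows "side_count (dual_cone (insert h N)) + side_count (dual_cone (insert (- h) N)) \<le> card N + 4"
proof -
  define A where "A = {n \<in> N. \<exists>y\<in>dual_cone N. n \<bullet> y = 0 \<and> 0 < h \<bullet> y}"
  define B where "B = {n \<in> N. \<exists>y\<in>dual_cone N. n \<bullet> y = 0 \<and> 0 < (- h) \<bullet> y}"
  have AB: "finite A" "finite B" "A \<union> B \<subseteq> N" using fin by (auto simp: A_def B_def)
  have pA: "dual_cone (insert h N) = dual_cone (insert h A)"
    unfolding A_def by (rule cut_sides[OF fin zp])
  have pB: "dual_cone (insert (- h) N) = dual_cone (insert (- h) B)"
    unfolding B_def by (rule cut_sides[OF fin zm(1)]) (use zm(2) in auto)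
  have "\<exists>r. h \<bullet> r = 0 \<and> i \<bullet> r = 0 \<and> (\<forall>m\<in>N. m \<noteq> i \<longrightarrow> 0 < m \<bullet> r)" if i: "i \<in> A \<inter> B" for i
  proof -
    have iN: "i \<in> N" using i by (simp add: A_def)
    obtain p where p: "i \<bullet> p = 0" "\<And>m. m \<in> N \<Longrightarrow> m \<noteq> i \<Longrightarrow> 0 < m \<bullet> p"
      using relative_interior_point_of_side[OF fin zp(1) iN irr[OF iN]] by metis
    obtain q where q: "q \<in> dual_cone N" "i \<bullet> q = 0" "0 < h \<bullet> q" using i by (auto simp: A_def)
    obtain s where s: "s \<in> dual_cone N" "i \<bullet> s = 0" "h \<bullet> s < 0" using i by (auto simp: B_def)
    \<comment> \<open>Move \<open>p\<close> within the side into the cutting plane, towards a point of the side beyond it.\<close>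
    have shift: ?thesis if f: "f \<in> dual_cone N" "i \<bullet> f = 0" and l: "0 \<le> l" "h \<bullet> p + l * (h \<bullet> f) = 0" for f l
    proof (intro exI[of _ "p + l *\<^sub>R f"] conjI ballI impI)
      fix m assume m: "m \<in> N" "m \<noteq> i"
      then show "0 < m \<bullet> (p + l *\<^sub>R f)"
        using p(2)[OF m] f l by (auto simp: inner_add_right dual_cone_def intro!: add_pos_nonneg)
    qed (use p f l in \<open>simp_all add: inner_add_right\<close>)
    show ?thesis
    proof (cases "0 \<le> h \<bullet> p")
      case True
      show ?thesis
        by (rule shift[OF s(1,2), of "(h \<bullet> p) / (- (h \<bullet> s))"]) (use True s(3) in \<open>auto simp: divide_nonneg_neg\<close>)
    next
      case False
      show ?thesis
        by (rule shift[OF q(1,2), of "- (h \<bullet> p) / (h \<bullet> q)"]) (use False q(3) in \<open>auto simp: divide_le_0_iff\<close>)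
    qed
  qed
  then obtain r where r: "\<And>i. i \<in> A \<inter> B \<Longrightarrow> h \<bullet> r i = 0 \<and> i \<bullet> r i = 0 \<and> (\<forall>m\<in>N. m \<noteq> i \<longrightarrow> 0 < m \<bullet> r i)"
    by metis
  have "card (A \<inter> B) \<le> 2"
  proof (rule at_most_two_crossed_sides[where h = h and r = r])
    show "h \<noteq> 0" using zp(2) by auto
  qed (use AB r in \<open>auto simp: subset_iff\<close>)
  moreover have "card A + card B = card (A \<union> B) + card (A \<inter> B)" by (rule card_Un_Int[OF AB(1,2)])
  moreover have "card (A \<union> B) \<le> card N" by (rule card_mono[OF fin AB(3)])
  moreover have "side_count (dual_cone (insert h N)) \<le> card A + 1"
    unfolding pA using side_count_le[of "insert h A"] AB(1)
    by (simp add: card_insert_if split: if_splits)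
  moreover have "side_count (dual_cone (insert (- h) N)) \<le> card B + 1"
    unfolding pB using side_count_le[of "insert (- h) B"] AB(2)
    by (simp add: card_insert_if split: if_splits)
  ultimately show ?thesis by linarith
qed

text \<open>For a set \<open>N\<close> of plane normals, the open and the closed cell that contains a generic point \<open>z\<close>. The product
\<open>(n \<bullet> z) * (n \<bullet> y)\<close> compares on which side of the plane \<open>z\<close> and \<open>y\<close> lie.\<close>

definition open_chamber :: "(real^3) set \<Rightarrow> real^3 \<Rightarrow> (real^3) set" where
  "open_chamber N z = {y. \<forall>n\<in>N. 0 < (n \<bullet> z) * (n \<bullet> y)}"

definition chamber :: "(real^3) set \<Rightarrow> real^3 \<Rightarrow> (real^3) set" where
  "chamber N z = {y. \<forall>n\<in>N. 0 \<le> (n \<bullet> z) * (n \<bullet> y)}"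

definition generic :: "(real^3) set \<Rightarrow> (real^3) set" where
  "generic N = {z. \<forall>n\<in>N. n \<bullet> z \<noteq> 0}"

definition chambers :: "(real^3) set \<Rightarrow> (real^3) set set" where
  "chambers N = chamber N ` generic N"

lemma chamber_eq_dual_cone: "chamber N z = dual_cone ((\<lambda>n. (n \<bullet> z) *\<^sub>R n) ` N)"
  by (simp add: chamber_def dual_cone_def)

lemma open_open_chamber: "finite N \<Longrightarrow> open (open_chamber N z)"
  unfolding open_chamber_def Collect_ball_eq
  by (intro open_INT ballI open_Collect_less continuous_intros)

lemma open_chamber_self: "z \<in> generic N \<Longrightarrow> z \<in> open_chamber N z"
  by (auto simp: open_chamber_def generic_def zero_less_mult_iff)

lemma open_chamberD:
  assumes "y \<in> open_chamber N z" shows "y \<in> generic N" "chamber N y = chamber N z"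
proof -
  show "y \<in> generic N" using assms by (force simp: open_chamber_def generic_def)
  have "0 \<le> (n \<bullet> y) * c \<longleftrightarrow> 0 \<le> (n \<bullet> z) * c" if "n \<in> N" for n c
    using assms that unfolding open_chamber_def
    by (auto simp: zero_less_mult_iff zero_le_mult_iff)
  then show "chamber N y = chamber N z" by (auto simp: chamber_def)
qed

lemma open_chamberI:
  assumes "y \<in> generic N" "z \<in> generic N" "y \<in> chamber N z"
  shows "y \<in> open_chamber N z"
  using assms by (force simp: open_chamber_def generic_def chamber_def less_le)

lemma chamber_self: "z \<in> chamber N z" by (simp add: chamber_def)

lemma open_chamber_subset: "open_chamber N z \<subseteq> chamber N z"
  by (auto simp: open_chamber_def chamber_def less_imp_le)

lemma open_chamber_shift:
  assumes "y \<in> chamber N z" "z \<in> generic N" "0 < \<epsilon>"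
  shows "y + \<epsilon> *\<^sub>R z \<in> open_chamber N z"
  unfolding open_chamber_def
proof (intro CollectI ballI)
  fix n assume n: "n \<in> N"
  have "0 < (n \<bullet> z) * (n \<bullet> z)" using n assms(2) by (auto simp: generic_def zero_less_mult_iff)
  then have "0 < \<epsilon> * ((n \<bullet> z) * (n \<bullet> z))" using assms by simp
  moreover have "0 \<le> (n \<bullet> z) * (n \<bullet> y)" using n assms by (simp add: chamber_def)
  moreover have "(n \<bullet> z) * (n \<bullet> (y + \<epsilon> *\<^sub>R z)) = (n \<bullet> z) * (n \<bullet> y) + \<epsilon> * ((n \<bullet> z) * (n \<bullet> z))"
    by (simp add: inner_add_right algebra_simps)
  ultimately show "0 < (n \<bullet> z) * (n \<bullet> (y + \<epsilon> *\<^sub>R z))" by linarith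
qed

lemma chamber_insert:
  assumes "z \<in> generic (insert h N)"
  shows "chamber (insert h N) z =
    chamber N z \<inter> (if 0 < h \<bullet> z then {y. 0 \<le> h \<bullet> y} else {y. 0 \<le> (- h) \<bullet> y})"
  using assms by (auto simp: chamber_def generic_def zero_le_mult_iff not_less)

lemma interior_dual_cone_pos:
  assumes "z \<in> interior (dual_cone N)" "n \<in> N" "n \<noteq> 0" shows "0 < n \<bullet> z"
proof -
  have "dual_cone N \<subseteq> {y. n \<bullet> y \<ge> 0}" using assms(2) by (auto simp: dual_cone_def)
  then have "z \<in> interior {y. n \<bullet> y \<ge> 0}" using assms(1) interior_mono by blast
  then show ?thesis using assms(3) by (simp add: interior_halfspace_ge)
qed

text \<open>\<open>\<P>\<close> is the set of chambers into which a new plane divides a given chamber: one or two. A single piece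
is the old chamber itself, and two pieces have at most four more sides than it. In both cases the
sum of \<open>side_count - 4\<close> does not increase.\<close>

lemma chamber_cut:
  assumes fin: "finite N" and z0: "z0 \<in> generic N" and h: "h \<noteq> 0"
    and pieces: "\<P> = chamber (insert h N) ` {z \<in> generic (insert h N). chamber N z = chamber N z0}"
  shows "finite \<P> \<and> (\<Sum>P\<in>\<P>. side_count P) + 4 \<le> side_count (chamber N z0) + 4 * card \<P>"
proof -
  define K where "K = chamber N z0"
  define Z where "Z = {z \<in> generic (insert h N). chamber N z = K}"
  have P: "\<P> = chamber (insert h N) ` Z" using pieces by (simp add: Z_def K_def)
  have ZI: "z \<in> Z" if "z \<in> open_chamber N z0" "h \<bullet> z \<noteq> 0" for z
    using open_chamberD[OF that(1)] that(2) by (auto simp: Z_def K_def generic_def)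
  have piece: "chamber (insert h N) z = K \<inter> (if 0 < h \<bullet> z then {y. 0 \<le> h \<bullet> y} else {y. 0 \<le> (- h) \<bullet> y})"
    if "z \<in> Z" for z using chamber_insert[of z h N] that by (simp add: Z_def)
  have hz: "h \<bullet> z \<noteq> 0" if "z \<in> Z" for z using that by (auto simp: Z_def generic_def)
  have uncut: "K \<subseteq> {y. 0 \<le> g \<bullet> y}" if g: "g = h \<or> g = - h" and none: "\<not> (\<exists>z\<in>Z. g \<bullet> z < 0)" for g
  proof (rule ccontr)
    assume "\<not> K \<subseteq> {y. 0 \<le> g \<bullet> y}"
    then obtain y where "y \<in> K" "\<not> 0 \<le> g \<bullet> y" by blast
    then have y: "y \<in> K" "g \<bullet> y < 0" by simp_all
    \<comment> \<open>Pushing \<open>y\<close> into the open chamber, but not back across the plane of \<open>h\<close>, gives a generic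
      point on the same side.\<close>
    define \<epsilon> where "\<epsilon> = (if g \<bullet> z0 \<le> 0 then 1 else - (g \<bullet> y) / (2 * (g \<bullet> z0)))"
    have "0 < \<epsilon>" "g \<bullet> (y + \<epsilon> *\<^sub>R z0) < 0"
      using y by (auto simp: \<epsilon>_def inner_add_right not_le divide_neg_pos)
    moreover from this have "y + \<epsilon> *\<^sub>R z0 \<in> Z"
      using y z0 g by (intro ZI open_chamber_shift) (auto simp: K_def)
    ultimately show False using none by blast
  qed
  have "Z \<noteq> {}"
  proof (cases "h \<bullet> z0 = 0")
    case False
    then show ?thesis using ZI[OF open_chamber_self[OF z0]] by blast
  next
    case True
    obtain e where e: "0 < e" "ball z0 e \<subseteq> open_chamber N z0"
      using open_open_chamber[OF fin, of z0] open_chamber_self[OF z0] open_contains_ball by blast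
    \<comment> \<open>\<open>z0\<close> lies on the new plane and has to be moved off it within its chamber.\<close>
    define z where "z = z0 + (e / (2 * norm h)) *\<^sub>R h"
    have "z \<in> ball z0 e" using e h by (simp add: z_def dist_norm)
    moreover have "h \<bullet> z \<noteq> 0" using True h e by (simp add: z_def inner_add_right)
    ultimately show ?thesis using ZI e by blast
  qed
  show ?thesis
  proof (cases "(\<exists>z\<in>Z. 0 < h \<bullet> z) \<and> (\<exists>z\<in>Z. h \<bullet> z < 0)")
    case False
    have "chamber (insert h N) z = K" if "z \<in> Z" for z
    proof (cases "0 < h \<bullet> z")
      case True
      with False that have "K \<subseteq> {y. 0 \<le> h \<bullet> y}" by (intro uncut) auto
      then show ?thesis using piece[OF that] True by auto
    next
      case neg: False
      then have "h \<bullet> z < 0" using hz[OF that] by simp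
      with False that have "K \<subseteq> {y. 0 \<le> (- h) \<bullet> y}" by (intro uncut) auto
      then show ?thesis using piece[OF that] neg by auto
    qed
    then have "\<P> = {K}" unfolding P using \<open>Z \<noteq> {}\<close> by auto
    then show ?thesis by (simp add: K_def)
  next
    case True
    then obtain zp zm where zp: "zp \<in> Z" "0 < h \<bullet> zp" and zm: "zm \<in> Z" "h \<bullet> zm < 0" by blast
    have "finite ((\<lambda>n. (n \<bullet> z0) *\<^sub>R n) ` N)" using fin by simp
    then obtain M where M: "finite M" "card M = side_count K" "K = dual_cone M"
      "\<And>n. n \<in> M \<Longrightarrow> dual_cone (M - {n}) \<noteq> dual_cone M"
      unfolding K_def chamber_eq_dual_cone by (rule irredundant_representation) blast
    have pos: "0 < n \<bullet> z" if "n \<in> M" "z \<in> Z" for n z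
    proof (rule interior_dual_cone_pos[OF _ that(1)])
      have "z \<in> open_chamber N z0"
        using that(2) z0 chamber_self[of z N] by (intro open_chamberI) (auto simp: Z_def K_def generic_def)
      then show "z \<in> interior (dual_cone M)" unfolding M(3)[symmetric] K_def
        using interior_maximal[OF open_chamber_subset open_open_chamber[OF fin]] by blast
      show "n \<noteq> 0"
      proof
        assume "n = 0"
        then have "dual_cone (M - {n}) = dual_cone M" by (auto simp: dual_cone_def)
        then show False using M(4)[OF that(1)] by blast
      qed
    qed
    have cut: "side_count (dual_cone (insert h M)) + side_count (dual_cone (insert (- h) M)) \<le> card M + 4"
      by (rule side_count_cut[OF M(1,4) _ zp(2) _ zm(2)]) (use pos zp zm in auto)
    have PP: "\<P> = {dual_cone (insert h M), dual_cone (insert (- h) M)}"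
    proof
      show "\<P> \<subseteq> {dual_cone (insert h M), dual_cone (insert (- h) M)}"
      proof
        fix Q assume "Q \<in> \<P>"
        then obtain z where z: "z \<in> Z" "Q = chamber (insert h N) z" unfolding P by blast
        then show "Q \<in> {dual_cone (insert h M), dual_cone (insert (- h) M)}"
          using piece[OF z(1)] by (cases "0 < h \<bullet> z") (simp_all add: dual_cone_insert M(3))
      qed
      have "dual_cone (insert h M) = chamber (insert h N) zp" "dual_cone (insert (- h) M) = chamber (insert h N) zm"
        using piece[OF zp(1)] piece[OF zm(1)] zp zm by (simp_all add: dual_cone_insert M(3))
      then show "{dual_cone (insert h M), dual_cone (insert (- h) M)} \<subseteq> \<P>" unfolding P using zp zm by blast
    qed
    have "zp \<in> dual_cone (insert h M)" "zp \<notin> dual_cone (insert (- h) M)"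
      using pos[OF _ zp(1)] zp(2) by (auto simp: dual_cone_def less_imp_le)
    then have "dual_cone (insert h M) \<noteq> dual_cone (insert (- h) M)" by blast
    then show ?thesis using cut M(2) unfolding PP by (simp add: K_def)
  qed
qed

lemma sum_side_count_le:
  assumes "finite N"
  shows "finite (chambers N) \<and> (\<Sum>K\<in>chambers N. side_count K) \<le> 4 * card (chambers N)"
  using assms
proof (induction N rule: finite_induct)
  case empty
  have "chambers {} = {UNIV}" by (auto simp: chambers_def chamber_def generic_def)
  moreover have "UNIV = dual_cone {}" by (simp add: dual_cone_def)
  ultimately show ?case using side_count_le[of "{}"] by simp
next
  case (insert h N)
  show ?case
  proof (cases "h = 0")
    case True
    then have "chambers (insert h N) = {}" by (simp add: chambers_def generic_def)
    then show ?thesis by simp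
  next
    case False
    define pieces where "pieces K = chamber (insert h N) ` {z \<in> generic (insert h N). chamber N z = K}" for K
    have cut: "finite (pieces K) \<and> (\<Sum>P\<in>pieces K. side_count P) + 4 \<le> side_count K + 4 * card (pieces K)"
      if "K \<in> chambers N" for K
      using that chamber_cut[OF insert.hyps(1) _ False] by (auto simp: chambers_def pieces_def)
    have un: "chambers (insert h N) = (\<Union>K\<in>chambers N. pieces K)"
      by (auto simp: chambers_def pieces_def generic_def)
    have disj: "pieces K \<inter> pieces K' = {}" if "K \<noteq> K'" for K K'
    proof (rule ccontr)
      assume "pieces K \<inter> pieces K' \<noteq> {}"
      then obtain z z' where z: "z \<in> generic (insert h N)" "z' \<in> generic (insert h N)"
          "chamber N z = K" "chamber N z' = K'" "chamber (insert h N) z = chamber (insert h N) z'"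
        by (auto simp: pieces_def)
      then have "z \<in> open_chamber (insert h N) z'"
        using chamber_self[of z "insert h N"] by (intro open_chamberI) auto
      then have "z \<in> open_chamber N z'" by (simp add: open_chamber_def)
      then show False using open_chamberD(2) z that by blast
    qed
    have fin: "finite (chambers N)" using insert.IH by blast
    have finU: "finite (chambers (insert h N))" unfolding un using fin cut by blast
    have "(\<Sum>P\<in>chambers (insert h N). side_count P) + 4 * card (chambers N)
        = (\<Sum>K\<in>chambers N. (\<Sum>P\<in>pieces K. side_count P) + 4)"
      unfolding un using fin cut disj by (subst sum.UNION_disjoint) (auto simp: sum.distrib)
    also have "\<dots> \<le> (\<Sum>K\<in>chambers N. side_count K + 4 * card (pieces K))"
      using cut by (intro sum_mono) auto
    also have "\<dots> = (\<Sum>K\<in>chambers N. side_count K) + 4 * card (chambers (insert h N))"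
      unfolding un using fin cut disj by (subst card_UN_disjoint) (auto simp: sum.distrib sum_distrib_left)
    also have "\<dots> \<le> 4 * card (chambers N) + 4 * card (chambers (insert h N))"
      using insert.IH by simp
    finally show ?thesis using finU by simp
  qed
qed

section \<open>From tilings by great circles to chambers\<close>

lemma great_circle_normal:
  assumes "great_circle G"
  obtains n where "n \<noteq> 0" "G = {y \<in> S2. n \<bullet> y = 0}"
proof -
  obtain P where P: "subspace P" "dim P = 2" "G = S2 \<inter> P" using assms by (auto simp: great_circle_def)
  have "dim P < DIM(real^3)" using P by simp
  then obtain n where n: "n \<noteq> 0" "span P \<subseteq> {y. n \<bullet> y = 0}" using lowdim_subset_hyperplane by blast
  have "P = {y. n \<bullet> y = 0}"
    by (rule subspace_dim_equal[OF P(1) subspace_hyperplane])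
      (use n span_base[of _ P] P(2) dim_hyperplane[OF n(1)] in auto)
  then show ?thesis using that n P by blast
qed

lemma nonzero_in_open_chamber:
  assumes "z \<in> generic N"
  obtains z' where "z' \<in> open_chamber N z" "z' \<noteq> 0"
proof (cases "z = 0")
  case True
  then have "N = {}" using assms by (auto simp: generic_def)
  then have "axis 1 1 \<in> open_chamber N z" by (simp add: open_chamber_def)
  then show ?thesis by (rule that) (simp add: axis_eq_0_iff)
next
  case False
  then show ?thesis using that open_chamber_self[OF assms] by blast
qed

lemma open_chamber_scaleR:
  assumes "y \<in> open_chamber N z" "0 < c" shows "c *\<^sub>R y \<in> open_chamber N z"
proof -
  have "0 < c * ((n \<bullet> z) * (n \<bullet> y))" if "n \<in> N" for n
    using assms that by (simp add: open_chamber_def)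
  then show ?thesis by (simp add: open_chamber_def mult_ac)
qed

lemma convex_open_chamber: "convex (open_chamber N z)"
proof -
  have "open_chamber N z = (\<Inter>n\<in>N. {y. ((n \<bullet> z) *\<^sub>R n) \<bullet> y > 0})"
    by (auto simp: open_chamber_def)
  moreover have "convex (\<Inter>n\<in>N. {y. ((n \<bullet> z) *\<^sub>R n) \<bullet> y > 0})"
    by (intro convex_INT convex_halfspace_gt)
  ultimately show ?thesis by simp
qed

lemma connected_cell: "connected (open_chamber N z \<inter> S2)"
proof (cases "0 \<in> open_chamber N z")
  case True
  then have "N = {}" by (auto simp: open_chamber_def)
  then have "open_chamber N z \<inter> S2 = S2" by (auto simp: open_chamber_def)
  then show ?thesis using connected_sphere[of "0::real^3" 1] by simp
next
  case False
  have "open_chamber N z \<inter> S2 = (\<lambda>y. (1 / norm y) *\<^sub>R y) ` open_chamber N z"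
  proof
    show "(\<lambda>y. (1 / norm y) *\<^sub>R y) ` open_chamber N z \<subseteq> open_chamber N z \<inter> S2"
    proof
      fix w assume "w \<in> (\<lambda>y. (1 / norm y) *\<^sub>R y) ` open_chamber N z"
      then obtain y where y: "y \<in> open_chamber N z" "w = (1 / norm y) *\<^sub>R y" by blast
      then have "y \<noteq> 0" using False by auto
      then show "w \<in> open_chamber N z \<inter> S2" using y open_chamber_scaleR[OF y(1), of "1 / norm y"] by simp
    qed
    show "open_chamber N z \<inter> S2 \<subseteq> (\<lambda>y. (1 / norm y) *\<^sub>R y) ` open_chamber N z"
      by (force simp: image_iff)
  qed
  moreover have "continuous_on (open_chamber N z) (\<lambda>y. (1 / norm y) *\<^sub>R y)"
    using False by (intro continuous_intros) auto
  ultimately show ?thesis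
    by (simp only:) (rule connected_continuous_image[OF _ convex_connected[OF convex_open_chamber]])
qed

text \<open>A connected set that avoids all planes stays on one side of each of them.\<close>

lemma cell_in_components:
  assumes z: "z \<in> generic N"
  shows "open_chamber N z \<inter> S2 \<in> components (S2 \<inter> generic N)"
proof -
  obtain z' where z': "z' \<in> open_chamber N z" "z' \<noteq> 0" using nonzero_in_open_chamber[OF z] .
  then have "(1 / norm z') *\<^sub>R z' \<in> open_chamber N z \<inter> S2"
    using open_chamber_scaleR[OF z'(1), of "1 / norm z'"] by simp
  then obtain u where u: "u \<in> open_chamber N z" "u \<in> S2" by blast
  show ?thesis unfolding in_components_maximal
  proof (intro conjI allI impI)
    show "open_chamber N z \<inter> S2 \<noteq> {}" using u by blast
    show "open_chamber N z \<inter> S2 \<subseteq> S2 \<inter> generic N" using open_chamberD by blast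
    show "connected (open_chamber N z \<inter> S2)" by (rule connected_cell)
    fix D assume D: "D \<noteq> {} \<and> open_chamber N z \<inter> S2 \<subseteq> D \<and> D \<subseteq> S2 \<inter> generic N \<and> connected D"
    have "y \<in> open_chamber N z" if y: "y \<in> D" for y
      unfolding open_chamber_def
    proof (intro CollectI ballI, rule ccontr)
      fix n assume n: "n \<in> N" and neg: "\<not> 0 < (n \<bullet> z) * (n \<bullet> y)"
      let ?a = "(n \<bullet> z) *\<^sub>R n"
      have "?a \<bullet> y \<le> 0" "0 \<le> ?a \<bullet> u" using n neg u by (auto simp: open_chamber_def less_imp_le)
      then obtain w where "w \<in> D" "?a \<bullet> w = 0"
        using connected_ivt_hyperplane[of D y u ?a 0] D y u by blast
      then show False using D n z by (auto simp: generic_def)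
    qed
    then show "D = open_chamber N z \<inter> S2" using D by blast
  qed
qed

text \<open>A point of the closed cell is approached from the open cell by moving it slightly in the direction
\<open>z\<close> and projecting back to the sphere.\<close>

lemma closure_cell:
  assumes z: "z \<in> generic N"
  shows "closure (open_chamber N z \<inter> S2) = chamber N z \<inter> S2"
proof
  have "closed (chamber N z \<inter> S2)" unfolding chamber_eq_dual_cone by (intro closed_Int closed_dual_cone closed_sphere)
  then show "closure (open_chamber N z \<inter> S2) \<subseteq> chamber N z \<inter> S2"
    using open_chamber_subset by (intro closure_minimal) auto
  show "chamber N z \<inter> S2 \<subseteq> closure (open_chamber N z \<inter> S2)"
  proof
    fix y assume y: "y \<in> chamber N z \<inter> S2"
    have l1: "((\<lambda>\<epsilon>. y + \<epsilon> *\<^sub>R z) \<longlongrightarrow> y + 0 *\<^sub>R z) (at_right 0)" by (intro tendsto_intros)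
    then have "((\<lambda>\<epsilon>. (1 / norm (y + \<epsilon> *\<^sub>R z)) *\<^sub>R (y + \<epsilon> *\<^sub>R z)) \<longlongrightarrow> (1 / norm (y + 0 *\<^sub>R z)) *\<^sub>R (y + 0 *\<^sub>R z)) (at_right 0)"
      using y by (intro tendsto_intros) auto
    then have lim: "((\<lambda>\<epsilon>. (1 / norm (y + \<epsilon> *\<^sub>R z)) *\<^sub>R (y + \<epsilon> *\<^sub>R z)) \<longlongrightarrow> y) (at_right 0)" using y by simp
    have nz: "\<forall>\<^sub>F \<epsilon> in at_right 0. y + \<epsilon> *\<^sub>R z \<noteq> 0"
      using l1 by (rule tendsto_imp_eventually_ne) (use y in auto)
    have "\<forall>\<^sub>F \<epsilon> in at_right 0. (0::real) < \<epsilon>" by (simp add: eventually_at_right_less)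
    with nz have "\<forall>\<^sub>F \<epsilon> in at_right 0. (1 / norm (y + \<epsilon> *\<^sub>R z)) *\<^sub>R (y + \<epsilon> *\<^sub>R z) \<in> closure (open_chamber N z \<inter> S2)"
    proof eventually_elim
      case (elim \<epsilon>)
      have "(1 / norm (y + \<epsilon> *\<^sub>R z)) *\<^sub>R (y + \<epsilon> *\<^sub>R z) \<in> open_chamber N z"
        using elim y z by (intro open_chamber_scaleR open_chamber_shift) auto
      then show ?case using elim by (intro closure_subset[THEN subsetD]) simp
    qed
    then show "y \<in> closure (open_chamber N z \<inter> S2)"
      by (rule Lim_in_closed_set[OF closed_closure _ _ lim]) simp
  qed
qed

text \<open>Let \<open>p\<close> be the point closest to the origin in the convex hull of the part of the cone on the sphere.
The hull lies in the half-space \<open>C \<le> x \<bullet> y\<close>, so \<open>p\<close> has norm at least \<open>C\<close>; and it lies in the half-space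
\<open>p \<bullet> p \<le> p \<bullet> y\<close>, so the direction of \<open>p\<close> is the center of a cap that contains the polygon and has
cosine \<open>norm p\<close>. This is the smallest such cap, and its center belongs to the cone.\<close>

lemma recenter_cap:
  assumes C: "0 < C" and x: "norm x = 1" and cap: "\<And>y. y \<in> dual_cone N \<Longrightarrow> C * norm y \<le> x \<bullet> y"
    and z: "z \<in> dual_cone N" "z \<noteq> 0"
  shows "\<exists>x'. norm x' = 1 \<and> x' \<in> dual_cone N \<and> (\<forall>y\<in>dual_cone N. C * norm y \<le> x' \<bullet> y)"
proof -
  define Q where "Q = convex hull (dual_cone N \<inter> S2)"
  have "compact (dual_cone N \<inter> S2)" by (intro closed_Int_compact) simp_all
  then have Q: "compact Q" "convex Q" "closed Q"
    unfolding Q_def by (simp_all add: compact_convex_hull compact_imp_closed)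
  have "(1 / norm z) *\<^sub>R z \<in> dual_cone N \<inter> S2" using z by (auto intro!: dual_cone_scaleR)
  then have Q0: "Q \<noteq> {}" unfolding Q_def using hull_subset by fastforce
  have QK: "Q \<subseteq> dual_cone N" unfolding Q_def by (rule hull_minimal) auto
  have "dual_cone N \<inter> S2 \<subseteq> {y. C \<le> x \<bullet> y}" using cap by force
  then have Qx: "Q \<subseteq> {y. C \<le> x \<bullet> y}" unfolding Q_def
    by (intro hull_minimal) (auto simp: convex_halfspace_ge)
  define p where "p = closest_point Q 0"
  have p: "p \<in> Q" unfolding p_def by (rule closest_point_in_set[OF Q(3) Q0])
  have dot: "p \<bullet> p \<le> p \<bullet> y" if "y \<in> Q" for y
    using closest_point_dot[OF Q(2,3) that, of 0] by (simp add: p_def inner_diff_right)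
  have np: "C \<le> norm p"
  proof -
    have "C \<le> x \<bullet> p" using p Qx by auto
    also have "\<dots> \<le> norm x * norm p" by (rule norm_cauchy_schwarz)
    finally show ?thesis using x by simp
  qed
  show ?thesis
  proof (intro exI[of _ "(1 / norm p) *\<^sub>R p"] conjI ballI)
    show "norm ((1 / norm p) *\<^sub>R p) = 1" using np C by auto
    show "(1 / norm p) *\<^sub>R p \<in> dual_cone N" using p QK by (auto intro!: dual_cone_scaleR)
    fix y assume y: "y \<in> dual_cone N"
    show "C * norm y \<le> ((1 / norm p) *\<^sub>R p) \<bullet> y"
    proof (cases "y = 0")
      case False
      have "(1 / norm y) *\<^sub>R y \<in> Q" unfolding Q_def
        using y False by (intro hull_inc) (auto intro!: dual_cone_scaleR)
      then have "norm p * norm p \<le> p \<bullet> ((1 / norm y) *\<^sub>R y)"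
        using dot by (metis dot_square_norm power2_eq_square)
      then have "norm p * norm p * norm y \<le> p \<bullet> y" using False by (simp add: field_simps)
      moreover have "C * norm y * norm p \<le> norm p * norm p * norm y"
        using np mult_right_mono[of C "norm p" "norm y * norm p"] by (simp add: mult_ac)
      ultimately have "C * norm y * norm p \<le> p \<bullet> y" by linarith
      moreover have "0 < norm p" using np C by linarith
      ultimately show ?thesis by (simp add: le_divide_eq mult_ac)
    qed simp
  qed
qed

theorem theorem6:
  fixes \<rho> :: real and \<C> :: "(real^3) set set"
  assumes "0 < \<rho>" and "\<rho> < pi / 2"
    and "finite \<C>"
    and "TS_covering \<rho> \<C>"
  shows "pi * (1 - cos \<rho>) / (4 * arctan (1 / cos \<rho>) - pi) \<le> cap_density \<C>"
proof -
  define C where "C = cos \<rho>"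
  have C: "0 < C" "C < 1"
    using assms(1,2) cos_gt_zero[of \<rho>] cos_monotone_0_pi[of 0 \<rho>] by (auto simp: C_def)
  have caps: "\<exists>x\<in>S2. K = spherical_cap x \<rho>" if "K \<in> \<C>" for K
    using assms(4) that by (simp add: TS_covering_def cap_covering_def)
  obtain \<G> f where G: "finite \<G>" "\<And>G. G \<in> \<G> \<Longrightarrow> great_circle G"
    and f: "inj_on f (tiling_cells \<G>)" "\<And>Q. Q \<in> tiling_cells \<G> \<Longrightarrow> f Q \<in> \<C> \<and> Q \<subseteq> f Q"
    using assms(4) unfolding TS_covering_def by blast
  have "\<forall>G\<in>\<G>. \<exists>n. n \<noteq> 0 \<and> G = {y \<in> S2. n \<bullet> y = 0}"
    by (intro ballI) (blast intro: great_circle_normal[OF G(2)])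
  from bchoice[OF this] obtain \<nu> where \<nu>: "\<forall>G\<in>\<G>. \<nu> G \<noteq> 0 \<and> G = {y \<in> S2. \<nu> G \<bullet> y = 0}" ..
  define N where "N = \<nu> ` \<G>"
  have finN: "finite N" and N0: "0 \<notin> N" using G(1) \<nu> by (auto simp: N_def)
  have "y \<in> S2 - \<Union>\<G> \<longleftrightarrow> y \<in> S2 \<inter> generic N" for y
    using \<nu> by (auto simp: N_def generic_def)
  then have compl: "S2 - \<Union>\<G> = S2 \<inter> generic N" by blast
  have cell: "K \<inter> S2 \<in> tiling_cells \<G>" if "K \<in> chambers N" for K
  proof -
    from that obtain z where z: "z \<in> generic N" "K = chamber N z" by (auto simp: chambers_def)
    then show ?thesis using cell_in_components[OF z(1)] closure_cell[OF z(1)]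
      by (auto simp: tiling_cells_def compl intro!: rev_image_eqI)
  qed
  have cone: "\<exists>M. finite M \<and> card M = side_count K \<and> K = dual_cone M" if "K \<in> chambers N" for K
  proof -
    from that obtain z where "K = chamber N z" by (auto simp: chambers_def)
    moreover have "finite ((\<lambda>n. (n \<bullet> z) *\<^sub>R n) ` N)" using finN by simp
    ultimately show ?thesis
      unfolding chamber_eq_dual_cone by (metis irredundant_representation)
  qed
  have sub: "K \<subseteq> K'" if K: "K \<in> chambers N" "K' \<in> chambers N" "K \<inter> S2 = K' \<inter> S2" for K K'
  proof
    fix y assume y: "y \<in> K"
    obtain M where "K = dual_cone M" using cone[OF K(1)] by blast
    moreover obtain M' where "K' = dual_cone M'" using cone[OF K(2)] by blast
    ultimately have M: "K = dual_cone M" "K' = dual_cone M'" .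
    show "y \<in> K'"
    proof (cases "y = 0")
      case False
      then have "(1 / norm y) *\<^sub>R y \<in> K \<inter> S2" using y M by (auto intro!: dual_cone_scaleR)
      then have "(1 / norm y) *\<^sub>R y \<in> K'" using K(3) by blast
      then have "norm y *\<^sub>R ((1 / norm y) *\<^sub>R y) \<in> K'" unfolding M by (rule dual_cone_scaleR) simp
      then show ?thesis using False by simp
    qed (simp add: M)
  qed
  have "inj_on (\<lambda>K. f (K \<inter> S2)) (chambers N)"
  proof (rule inj_onI)
    fix K K' assume K: "K \<in> chambers N" "K' \<in> chambers N" "f (K \<inter> S2) = f (K' \<inter> S2)"
    then have "K \<inter> S2 = K' \<inter> S2" using inj_onD[OF f(1)] cell by blast
    then show "K = K'" using sub[OF K(1,2)] sub[OF K(2,1)] by auto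
  qed
  moreover have "(\<lambda>K. f (K \<inter> S2)) ` chambers N \<subseteq> \<C>" using f(2) cell by blast
  ultimately have cardF: "card (chambers N) \<le> card \<C>" using assms(3) by (rule card_inj_on_le)
  have bound: "solid_angle K \<le> side_weight C * side_count K + 2 * pi * angle_weight C"
    if K: "K \<in> chambers N" for K
  proof -
    obtain M where M: "finite M" "card M = side_count K" "K = dual_cone M" using cone[OF K] by blast
    have "f (K \<inter> S2) \<in> \<C>" "K \<inter> S2 \<subseteq> f (K \<inter> S2)" using f(2)[OF cell[OF K]] by auto
    then obtain x where x: "x \<in> S2" "K \<inter> S2 \<subseteq> spherical_cap x \<rho>" using caps by metis
    have cap: "C * norm y \<le> x \<bullet> y" if y: "y \<in> dual_cone M" for y
    proof (cases "y = 0")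
      case False
      then have "(1 / norm y) *\<^sub>R y \<in> spherical_cap x \<rho>"
        using x(2) M(3) y by (auto intro!: dual_cone_scaleR)
      then show ?thesis using False by (simp add: spherical_cap_def C_def inner_commute field_simps)
    qed simp
    have nx: "norm x = 1" using x(1) by simp
    obtain z where z: "z \<in> generic N" "K = chamber N z" using K by (auto simp: chambers_def)
    obtain z' where "z' \<in> open_chamber N z" and z'0: "z' \<noteq> 0"
      by (rule nonzero_in_open_chamber[OF z(1)])
    then have z': "z' \<in> dual_cone M" using open_chamber_subset unfolding M(3)[symmetric] z(2) by blast
    obtain x' where x': "norm x' = 1" "x' \<in> dual_cone M"
        "\<And>y. y \<in> dual_cone M \<Longrightarrow> C * norm y \<le> x' \<bullet> y"
      using recenter_cap[OF C(1) nx cap z' z'0] by blast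
    have "solid_angle (dual_cone M) \<le> side_weight C * card M + 2 * pi * angle_weight C"
      by (rule cell_bound[OF C x'(1,2) M(1) x'(3)])
    then show ?thesis unfolding M(2) M(3)[symmetric] .
  qed
  have count: "finite (chambers N)" "(\<Sum>K\<in>chambers N. side_count K) \<le> 4 * card (chambers N)"
    using sum_side_count_le[OF finN] by auto
  define F where "F = real (card (chambers N))"
  have "4 * pi = solid_angle (dual_cone {})" using measure_unit_ball by (simp add: solid_angle_def dual_cone_def)
  also have "\<dots> \<le> (\<Sum>K\<in>chambers N. solid_angle K)"
  proof (rule solid_angle_subadditive[OF count(1)])
    show "closed K" if "K \<in> chambers N" for K using cone[OF that] by auto
    show "negligible (\<Union>n\<in>N. {y. n \<bullet> y = 0})"
      using finN N0 by (intro negligible_Union) (auto intro!: negligible_hyperplane)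
    show "dual_cone {} \<subseteq> (\<Union>K\<in>chambers N. K) \<union> (\<Union>n\<in>N. {y. n \<bullet> y = 0})"
    proof
      fix y
      show "y \<in> (\<Union>K\<in>chambers N. K) \<union> (\<Union>n\<in>N. {y. n \<bullet> y = 0})"
        using chamber_self[of y N] by (cases "y \<in> generic N") (auto simp: chambers_def generic_def)
    qed
  qed simp
  also have "\<dots> \<le> (\<Sum>K\<in>chambers N. side_weight C * side_count K + 2 * pi * angle_weight C)"
    by (rule sum_mono) (rule bound)
  also have "\<dots> = side_weight C * real (\<Sum>K\<in>chambers N. side_count K) + 2 * pi * angle_weight C * F"
    by (simp add: sum.distrib sum_distrib_left F_def)
  also have "\<dots> \<le> side_weight C * (4 * F) + 2 * pi * angle_weight C * F"
  proof -
    have "real (\<Sum>K\<in>chambers N. side_count K) \<le> 4 * F" using count(2) unfolding F_def by linarith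
    then show ?thesis using side_weight_nonneg[OF C] by (intro add_right_mono mult_left_mono)
  qed
  also have "\<dots> = F * (4 * excess C (pi / 4))" by (simp add: side_weight_def algebra_simps)
  also have "4 * excess C (pi / 4) = 2 * (4 * arctan (1 / C) - pi)"
  proof -
    have "arctan (1 / C) = pi / 2 - arctan C" using arctan_inverse[of C] C by (simp add: inverse_eq_divide)
    then show ?thesis by (simp add: excess_def tan_45)
  qed
  finally have F: "2 * pi \<le> F * (4 * arctan (1 / C) - pi)" by (simp add: algebra_simps)
  have D: "0 < 4 * arctan (1 / C) - pi"
  proof -
    have "arctan 1 < arctan (1 / C)" by (subst arctan_less_iff) (use C in simp)
    then show ?thesis unfolding arctan_one by linarith
  qed
  have "pi * (1 - C) / (4 * arctan (1 / C) - pi) = (2 * pi / (4 * arctan (1 / C) - pi)) * ((1 - C) / 2)"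
    using D by (simp add: field_simps)
  also have "\<dots> \<le> F * ((1 - C) / 2)"
    using F D C by (intro mult_right_mono) (simp_all add: divide_le_eq)
  also have "\<dots> \<le> real (card \<C>) * ((1 - C) / 2)"
    using cardF C by (intro mult_right_mono) (simp_all add: F_def)
  also have "\<dots> = (\<Sum>K\<in>\<C>. 2 * pi * (1 - C)) / (4 * pi)" by simp
  also have "\<dots> \<le> cap_density \<C>"
    unfolding cap_density_def Sarea_S2
  proof (intro divide_right_mono sum_mono)
    fix K assume "K \<in> \<C>"
    then obtain x where "x \<in> S2" "K = spherical_cap x \<rho>" using caps by blast
    then show "2 * pi * (1 - C) \<le> Sarea K" using Sarea_cap_ge[of x \<rho>] assms(1,2) by (simp add: C_def)
  qed simp
  finally show ?thesis by (simp add: C_def)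
qed

end
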